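(* $\textsc{Circle-Recognition}$ belongs to $\mathsf{dMAM}[\log n]$: there is a three-interaction (Merlin–Arthur–Merlin) distributed interactive protocol with certificates and messages of $\mathcal{O}(\log n)$ bits that decides whether the connected $n$-node network $G$ is a circle graph, with completeness and soundness error at most $1/3$.
   Context: A circle graph is the intersection graph of a family of chords of a circle. $\textsc{Circle-Recognition}$ is the set of configurations $\langle G,\mathrm{id}\rangle$ with $G$ a circle graph. Distributed setting: $G=(V,E)$ is a simple connected $n$-node graph, each node has a unique identifier in $\{1,\dots,\mathrm{poly}(n)\}$, nodes know only a polynomial upper bound on $n$. A $\mathsf{dMAM}[f(n)]$ protocol: an untrusted, computationally unbounded prover (Merlin) who knows the whole configuration gives each node a certificate; then a public random string $r$ shared by all nodes (and seen by Merlin) is drawn; then Merlin gives each node a second certificate depending on $r$; finally, in one deterministic round each node sends one message to each neighbor (depending on its id, input, $r$ and certificates) and accepts or rejects. Certificates and messages have $\mathcal{O}(f(n))$ bits. Completeness: if $G$ is in the class, some prover makes all nodes accept with probability $\ge 2/3$. Soundness: if not, for every prover some node rejects with probability $\ge 2/3$. *)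

theory Defs
  imports "HOL-Analysis.Analysis" "HOL-Library.Multiset"
begin

definition circle_graph :: "nat set \<Rightarrow> (nat \<Rightarrow> nat \<Rightarrow> bool) \<Rightarrow> bool" where
  "circle_graph V E \<longleftrightarrow>
     (\<exists>f :: nat \<Rightarrow> complex \<times> complex.
        (\<forall>v\<in>V. cmod (fst (f v)) = 1 \<and> cmod (snd (f v)) = 1 \<and> fst (f v) \<noteq> snd (f v)) \<and>
        (\<forall>u\<in>V. \<forall>v\<in>V. u \<noteq> v \<longrightarrow>
           (E u v \<longleftrightarrow>
              closed_segment (fst (f u)) (snd (f u)) \<inter> closed_segment (fst (f v)) (snd (f v)) \<noteq> {})))"

text \<open>Nodes are identified with their (unique) identifiers, which are natural numbers in
{1..n^c}, where n = card V. The graph is simple (symmetric, irreflexive), finite,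
nonempty and connected.\<close>

definition valid_config :: "nat \<Rightarrow> nat set \<Rightarrow> (nat \<Rightarrow> nat \<Rightarrow> bool) \<Rightarrow> bool" where
  "valid_config c V E \<longleftrightarrow>
     finite V \<and> V \<noteq> {} \<and> V \<subseteq> {1 .. card V ^ c} \<and>
     (\<forall>u v. E u v \<longrightarrow> u \<in> V \<and> v \<in> V) \<and>
     (\<forall>u v. E u v \<longrightarrow> E v u) \<and> (\<forall>v. \<not> E v v) \<and>
     (\<forall>u\<in>V. \<forall>v\<in>V. E\<^sup>*\<^sup>* u v)"

definition short :: "real \<Rightarrow> nat \<Rightarrow> bool list \<Rightarrow> bool" where
  "short k n x \<longleftrightarrow> real (length x) \<le> k * (log 2 (real n) + 1)"

definition prob_bits :: "nat \<Rightarrow> (bool list \<Rightarrow> bool) \<Rightarrow> real" where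
  "prob_bits L P = real (card {r. length r = L \<and> P r}) / 2 ^ L"

text \<open>Verification round. msg N v r x y is the message node v (knowing the bound N, its id v,
the public random string r, its first certificate x and second certificate y) sends to all
its neighbours; dec N v r x y M is its accept/reject decision, where M is the multiset of
messages received from its neighbours. The prover is given by the first certificates
c1 (independent of r) and the second certificates c2 r (depending on r).\<close>

definition all_accept ::
  "(nat \<Rightarrow> nat \<Rightarrow> bool list \<Rightarrow> bool list \<Rightarrow> bool list \<Rightarrow> bool list) \<Rightarrow>
   (nat \<Rightarrow> nat \<Rightarrow> bool list \<Rightarrow> bool list \<Rightarrow> bool list \<Rightarrow> bool list multiset \<Rightarrow> bool) \<Rightarrow>
   nat \<Rightarrow> nat set \<Rightarrow> (nat \<Rightarrow> nat \<Rightarrow> bool) \<Rightarrow>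
   (nat \<Rightarrow> bool list) \<Rightarrow> (bool list \<Rightarrow> nat \<Rightarrow> bool list) \<Rightarrow> bool list \<Rightarrow> bool" where
  "all_accept msg dec N V E c1 c2 r \<longleftrightarrow>
     (\<forall>v\<in>V. dec N v r (c1 v) (c2 r v)
               (image_mset (\<lambda>u. msg N u r (c1 u) (c2 r u)) (mset_set {u\<in>V. E v u})))"

definition prover_ok :: "real \<Rightarrow> nat \<Rightarrow> nat set \<Rightarrow> (nat \<Rightarrow> bool list) \<Rightarrow> (bool list \<Rightarrow> nat \<Rightarrow> bool list) \<Rightarrow> bool" where
  "prover_ok k n V c1 c2 \<longleftrightarrow> (\<forall>v\<in>V. short k n (c1 v)) \<and> (\<forall>r. \<forall>v\<in>V. short k n (c2 r v))"

definition in_dMAM_log :: "(nat set \<Rightarrow> (nat \<Rightarrow> nat \<Rightarrow> bool) \<Rightarrow> bool) \<Rightarrow> bool" where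
  "in_dMAM_log P \<longleftrightarrow>
     (\<forall>c::nat. c \<ge> 1 \<longrightarrow>
       (\<exists>(k::real) (L::nat \<Rightarrow> nat)
          (msg :: nat \<Rightarrow> nat \<Rightarrow> bool list \<Rightarrow> bool list \<Rightarrow> bool list \<Rightarrow> bool list)
          (dec :: nat \<Rightarrow> nat \<Rightarrow> bool list \<Rightarrow> bool list \<Rightarrow> bool list \<Rightarrow> bool list multiset \<Rightarrow> bool).
        \<forall>V E N. valid_config c V E \<and> card V \<le> N \<and> N \<le> card V ^ c \<longrightarrow>
          (\<forall>v\<in>V. \<forall>r x y. short k (card V) x \<longrightarrow> short k (card V) y \<longrightarrow>
                short k (card V) (msg N v r x y)) \<and>
          (P V E \<longrightarrow> (\<exists>c1 c2. prover_ok k (card V) V c1 c2 \<and>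
                prob_bits (L N) (all_accept msg dec N V E c1 c2) \<ge> 2/3)) \<and>
          (\<not> P V E \<longrightarrow> (\<forall>c1 c2. prover_ok k (card V) V c1 c2 \<longrightarrow>
                prob_bits (L N) (\<lambda>r. \<not> all_accept msg dec N V E c1 c2 r) \<ge> 2/3))))"

end

theory Submission
  imports Defs
begin

text \<open>Cut the circle open. Merlin tells each node, for both endpoints of its chord, how many left and how many
  right endpoints precede it. Reading the endpoints in order then traces a monotone lattice path from
  \<open>(0, 0)\<close> to \<open>(n, n)\<close>, and conversely a set of unit steps that conserves flow between these two
  points is such a path, so all claimed counts are correct. Conservation is a linear identity between
  multiplicities of lattice points; Arthur tests it with random weights in \<open>{0..3}\<close>, a nonzero integer form
  vanishing with probability at most 1/4, and Merlin helps to add up the weights along a spanning tree.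

  Each node checks that its neighbours' chords cross its own. Correct counts give each node the number of
  chords crossing it from the left minus the number crossing it to the right. If this agrees with the
  difference counted among its neighbours, then by induction along the left endpoints every crossing chord
  belongs to a neighbour.\<close>

subsection \<open>From local predicates to bit strings\<close>

text \<open>A node cannot see chords that cross its own without being neighbours, and lattice states
  do not count crossings directly: between the two ends of a chord, left endpoints count crossings
  to the right plus nested chords, and right endpoints count crossings from the left plus nested
  chords. The unknown number of nested chords cancels in the difference, so the difference is what
  can be compared.

  Certificates and messages are bounded in length, the random string is not. Hence every lattice
  point can have its own independent weight, and only sums of small weights, linear in
  \<open>N\<close>, are communicated. Four values per weight give error 1/4, below the allowed 1/3,
  and make the number of outcomes a power of two, so that uniform bits encode them.

  States and tree are committed before the weights are drawn. The linear form under test is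
  therefore fixed, and the second certificates only help to evaluate it.\<close>

text \<open>A protocol without bit strings: certificates range over sets \<open>T1 N\<close>, \<open>T2 N\<close> of polynomial size,
  and the public coins over a set \<open>\<Omega> N\<close> whose size is a power of two. The local predicate
  \<open>Q N \<omega> v S a b\<close> is the decision of node \<open>v\<close> with neighbourhood \<open>S\<close>; that it depends on the certificates
  of \<open>v\<close> and \<open>S\<close> only is the fourth conjunct, so broadcasting identifier and certificates suffices as
  a message. Completeness is required without error.\<close>

definition dMAM_protocol ::
  "nat \<Rightarrow> (nat set \<Rightarrow> (nat \<Rightarrow> nat \<Rightarrow> bool) \<Rightarrow> bool) \<Rightarrow> nat \<Rightarrow> (nat \<Rightarrow> 'a set) \<Rightarrow> (nat \<Rightarrow> 'b set) \<Rightarrow>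
   (nat \<Rightarrow> 'w set) \<Rightarrow> (nat \<Rightarrow> 'w \<Rightarrow> nat \<Rightarrow> nat set \<Rightarrow> (nat \<Rightarrow> 'a) \<Rightarrow> (nat \<Rightarrow> 'b) \<Rightarrow> bool) \<Rightarrow> bool" where
  "dMAM_protocol c P d T1 T2 \<Omega> Q \<longleftrightarrow>
     (\<forall>N. finite (T1 N) \<and> card (T1 N) \<le> (N + 2) ^ d) \<and>
     (\<forall>N. finite (T2 N) \<and> card (T2 N) \<le> (N + 2) ^ d) \<and>
     (\<forall>N. \<exists>l. card (\<Omega> N) = 2 ^ l) \<and>
     (\<forall>N \<omega> v S a b a' b'. (\<forall>u\<in>insert v S. a u = a' u \<and> b u = b' u) \<longrightarrow>
         Q N \<omega> v S a b \<longrightarrow> Q N \<omega> v S a' b') \<and>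
     (\<forall>V E N. valid_config c V E \<and> card V \<le> N \<longrightarrow>
        (P V E \<longrightarrow> (\<exists>a. (\<forall>v\<in>V. a v \<in> T1 N) \<and>
           (\<forall>\<omega>\<in>\<Omega> N. \<exists>b. (\<forall>v\<in>V. b v \<in> T2 N) \<and> (\<forall>v\<in>V. Q N \<omega> v {u\<in>V. E v u} a b)))) \<and>
        (\<not> P V E \<longrightarrow> (\<forall>a. (\<forall>v\<in>V. a v \<in> T1 N) \<longrightarrow>
           3 * card {\<omega>\<in>\<Omega> N. \<exists>b. (\<forall>v\<in>V. b v \<in> T2 N) \<and>
                       (\<forall>v\<in>V. Q N \<omega> v {u\<in>V. E v u} a b)} \<le> card (\<Omega> N))))"

lemma card_bit_lists: "card {x :: bool list. length x = m} = 2 ^ m"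
  using card_lists_length_eq[of "UNIV :: bool set" m] by simp

lemma finite_bit_lists: "finite {x :: bool list. length x = m}"
  using finite_lists_length_eq[of "UNIV :: bool set" m] by simp

lemma bit_encoding_exists:
  assumes "finite T" "card T \<le> 2 ^ m"
  shows "\<exists>e :: 'a \<Rightarrow> bool list. inj_on e T \<and> (\<forall>t\<in>T. length (e t) = m)"
proof -
  have "card T \<le> card {x :: bool list. length x = m}"
    using assms by (simp add: card_bit_lists)
  from card_le_inj[OF assms(1) finite_bit_lists this] show ?thesis by blast
qed

lemma prob_bits_not: "prob_bits l (\<lambda>r. \<not> A r) = 1 - prob_bits l A"
proof -
  have "{r. length r = l} = {r. length r = l \<and> A r} \<union> {r. length r = l \<and> \<not> A r}" by blast
  also have "card \<dots> = card {r. length r = l \<and> A r} + card {r. length r = l \<and> \<not> A r}"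
    by (intro card_Un_disjoint finite_subset[OF _ finite_bit_lists[of l]]) auto
  finally have "card {r :: bool list. length r = l} = \<dots>" .
  then have "2 ^ l = real (card {r. length r = l \<and> A r}) + real (card {r. length r = l \<and> \<not> A r})"
    unfolding card_bit_lists by (metis of_nat_add of_nat_numeral of_nat_power)
  then have "real (card {r. length r = l \<and> \<not> A r}) = 2 ^ l - real (card {r. length r = l \<and> A r})"
    by simp
  then show ?thesis by (simp add: prob_bits_def diff_divide_distrib)
qed

lemma exists_bit_width: "\<exists>l. N + 2 \<le> 2 ^ l \<and> real l \<le> log 2 (real N + 2) + 1"
proof -
  let ?x = "log 2 (real N + 2)"
  let ?l = "nat \<lceil>?x\<rceil>"
  have pos: "0 \<le> ?x" by simp
  have "real N + 2 = 2 powr ?x" by simp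
  also have "\<dots> \<le> 2 powr real ?l"
    by (intro powr_mono) (auto simp: pos real_nat_ceiling_ge)
  also have "\<dots> = 2 ^ ?l" by (rule powr_realpow) simp
  finally have "real (N + 2) \<le> real (2 ^ ?l)" by simp
  then have "N + 2 \<le> 2 ^ ?l" by (simp only: of_nat_le_iff)
  moreover have "real ?l \<le> ?x + 1"
    using pos by linarith
  ultimately show ?thesis by blast
qed

text \<open>Encoding lengths are proportional to \<open>log N\<close>, because nodes know only
  \<open>N\<close>, while \<open>short\<close> measures against \<open>n\<close>; the polynomial
  relation costs the factor \<open>c\<close>. The 3 is 1 for rounding up and 2 from
  \<open>N + 2 \<le> 4 * N\<close>.\<close>

lemma log_polynomial_bound:
  assumes "1 \<le> n" "n \<le> N" "N \<le> n ^ c"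
  shows "log 2 (real N + 2) + 1 \<le> real (c + 3) * (log 2 (real n) + 1)"
proof -
  have N: "1 \<le> N" using assms by simp
  have "log 2 (real N + 2) \<le> log 2 (4 * real N)"
    using N by (subst log_le_cancel_iff) auto
  also have "\<dots> = 2 + log 2 (real N)"
    using N log2_of_power_eq[of 4 2] by (simp add: log_mult)
  also have "log 2 (real N) \<le> log 2 (real (n ^ c))"
    using N assms by (intro log_le_cancel_iff[THEN iffD2]) (simp_all flip: of_nat_power)
  also have "\<dots> = real c * log 2 (real n)"
    using assms by (simp add: log_nat_power)
  finally have "log 2 (real N + 2) + 1 \<le> 3 + real c * log 2 (real n)" by simp
  moreover have "0 \<le> log 2 (real n)" using assms by simp
  ultimately show ?thesis by (simp add: algebra_simps)
qed

lemma Suc_power_le: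
  assumes "1 \<le> c"
  shows "Suc (N ^ c) \<le> (N + 2) ^ c"
  using assms by (intro Suc_leI power_strict_mono) auto

text \<open>Certificates become block codes of fixed width, and a message packs the identifier and
  both certificates, from which the receiver rebuilds its neighbourhood. Provers that adapt to
  \<open>r\<close> are covered because the abstract soundness counts the coins for which some second
  certificates work.\<close>

lemma in_dMAM_logI:
  fixes T1 :: "nat \<Rightarrow> nat \<Rightarrow> 'a set" and T2 :: "nat \<Rightarrow> nat \<Rightarrow> 'b set" and \<Omega> :: "nat \<Rightarrow> nat \<Rightarrow> 'w set"
  assumes prot: "\<And>c. c \<ge> 1 \<Longrightarrow> dMAM_protocol c P (d c) (T1 c) (T2 c) (\<Omega> c) (Q c)"
  shows "in_dMAM_log P"
  unfolding in_dMAM_log_def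
proof (intro allI impI)
  fix c :: nat assume c: "c \<ge> 1"
  note pr = prot[OF c, unfolded dMAM_protocol_def]
  let ?T1 = "T1 c" and ?T2 = "T2 c" and ?\<Omega> = "\<Omega> c" and ?Q = "Q c" and ?d = "d c"
  have T1: "finite (?T1 N)" "card (?T1 N) \<le> (N + 2) ^ ?d" for N using pr by auto
  have T2: "finite (?T2 N)" "card (?T2 N) \<le> (N + 2) ^ ?d" for N using pr by auto
  have "\<forall>N. \<exists>l. card (?\<Omega> N) = 2 ^ l" using pr by auto
  then obtain L where L: "\<And>N. card (?\<Omega> N) = 2 ^ L N" by metis
  have cong: "?Q N \<omega> v S a b \<Longrightarrow> ?Q N \<omega> v S a' b'"
    if "\<forall>u\<in>insert v S. a u = a' u \<and> b u = b' u" for N \<omega> v S a b a' b'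
    using pr that by blast
  have complete: "\<exists>a. (\<forall>v\<in>V. a v \<in> ?T1 N) \<and>
      (\<forall>\<omega>\<in>?\<Omega> N. \<exists>b. (\<forall>v\<in>V. b v \<in> ?T2 N) \<and> (\<forall>v\<in>V. ?Q N \<omega> v {u\<in>V. E v u} a b))"
    if "valid_config c V E" "card V \<le> N" "P V E" for V E N
    using pr that by blast
  have sound: "3 * card {\<omega>\<in>?\<Omega> N. \<exists>b. (\<forall>v\<in>V. b v \<in> ?T2 N) \<and>
      (\<forall>v\<in>V. ?Q N \<omega> v {u\<in>V. E v u} a b)} \<le> card (?\<Omega> N)"
    if "valid_config c V E" "card V \<le> N" "\<not> P V E" "\<forall>v\<in>V. a v \<in> ?T1 N" for V E N a
    using pr that by blast

  have "\<exists>\<phi>. bij_betw \<phi> {r :: bool list. length r = L N} (?\<Omega> N)" for N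
  proof (rule finite_same_card_bij[OF finite_bit_lists])
    show "finite (?\<Omega> N)" using L[of N] by (metis card.infinite power_not_zero zero_neq_numeral)
  qed (simp add: L card_bit_lists)
  then obtain \<phi> where \<phi>: "\<And>N. bij_betw (\<phi> N) {r :: bool list. length r = L N} (?\<Omega> N)" by metis

  obtain w where w: "\<And>N. N + 2 \<le> 2 ^ w N" "\<And>N. real (w N) \<le> log 2 (real N + 2) + 1"
    using exists_bit_width by metis
  \<comment> \<open>The exponent \<open>c + 2 * ?d\<close> is that of a message: an identifier up to
    \<open>N ^ c\<close> and two certificates. One width for all three codes gives a single constant
    \<open>k\<close>.\<close>
  define m where "m N = w N * (c + 2 * ?d)" for N
  define T3 where "T3 N = {..N ^ c} \<times> ?T1 N \<times> ?T2 N" for N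
  have pow_le: "(N + 2) ^ j \<le> 2 ^ m N" if "j \<le> c + 2 * ?d" for N j
  proof -
    have "(N + 2) ^ j \<le> (2 ^ w N) ^ j" by (rule power_mono[OF w(1)]) simp
    also have "\<dots> = 2 ^ (w N * j)" by (simp add: power_mult)
    also have "\<dots> \<le> 2 ^ m N" unfolding m_def using that by (intro power_increasing) auto
    finally show ?thesis .
  qed
  have "card (?T1 N) \<le> 2 ^ m N" for N
    using T1(2)[of N] pow_le[of ?d N] by simp
  then have "\<forall>N. \<exists>e :: 'a \<Rightarrow> bool list. inj_on e (?T1 N) \<and> (\<forall>t\<in>?T1 N. length (e t) = m N)"
    using bit_encoding_exists T1(1) by blast
  then obtain e1 :: "nat \<Rightarrow> 'a \<Rightarrow> bool list" where
    e1: "\<And>N. inj_on (e1 N) (?T1 N)" "\<And>N t. t \<in> ?T1 N \<Longrightarrow> length (e1 N t) = m N" by metis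
  have "card (?T2 N) \<le> 2 ^ m N" for N
    using T2(2)[of N] pow_le[of ?d N] by simp
  then have "\<forall>N. \<exists>e :: 'b \<Rightarrow> bool list. inj_on e (?T2 N) \<and> (\<forall>t\<in>?T2 N. length (e t) = m N)"
    using bit_encoding_exists T2(1) by blast
  then obtain e2 :: "nat \<Rightarrow> 'b \<Rightarrow> bool list" where
    e2: "\<And>N. inj_on (e2 N) (?T2 N)" "\<And>N t. t \<in> ?T2 N \<Longrightarrow> length (e2 N t) = m N" by metis
  have "card (T3 N) \<le> 2 ^ m N" for N
  proof -
    have "card (T3 N) \<le> (N + 2) ^ c * ((N + 2) ^ ?d * (N + 2) ^ ?d)"
      unfolding T3_def card_cartesian_product using Suc_power_le[OF c] T1(2)[of N] T2(2)[of N]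
      by (intro mult_le_mono) auto
    also have "\<dots> = (N + 2) ^ (c + 2 * ?d)" by (simp add: power_add mult_2)
    also have "\<dots> \<le> 2 ^ m N" by (rule pow_le) simp
    finally show ?thesis .
  qed
  moreover have "finite (T3 N)" for N using T1 T2 by (simp add: T3_def)
  ultimately have "\<forall>N. \<exists>e :: nat \<times> 'a \<times> 'b \<Rightarrow> bool list. inj_on e (T3 N) \<and> (\<forall>t\<in>T3 N. length (e t) = m N)"
    using bit_encoding_exists by blast
  then obtain e3 :: "nat \<Rightarrow> nat \<times> 'a \<times> 'b \<Rightarrow> bool list" where
    e3: "\<And>N. inj_on (e3 N) (T3 N)" "\<And>N t. t \<in> T3 N \<Longrightarrow> length (e3 N t) = m N" by metis
  define d1 where "d1 N = inv_into (?T1 N) (e1 N)" for N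
  define d2 where "d2 N = inv_into (?T2 N) (e2 N)" for N
  define d3 where "d3 N = inv_into (T3 N) (e3 N)" for N

  define k where "k = real (c + 2 * ?d) * real (c + 3)"
  have short_m: "short k (card V) x"
    if "valid_config c V E" "card V \<le> N" "N \<le> card V ^ c" "length x \<le> m N" for V E N x
  proof -
    have n: "1 \<le> card V" using that(1) by (auto simp: valid_config_def Suc_leI card_gt_0_iff)
    have "real (length x) \<le> real (c + 2 * ?d) * real (w N)"
      using that(4) unfolding m_def of_nat_mult[symmetric] of_nat_le_iff by (simp only: mult.commute)
    also have "\<dots> \<le> real (c + 2 * ?d) * (real (c + 3) * (log 2 (real (card V)) + 1))"
      by (intro mult_left_mono order.trans[OF w(2) log_polynomial_bound[OF n that(2,3)]]) simp
    finally show ?thesis by (simp add: short_def k_def mult.assoc)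
  qed

  \<comment> \<open>A malformed certificate makes its owner reject, so the message it sends then is irrelevant;
     sending the empty string keeps it short.\<close>
  define ok where "ok N x y \<longleftrightarrow> x \<in> e1 N ` ?T1 N \<and> y \<in> e2 N ` ?T2 N" for N x y
  define msg where "msg N v (r :: bool list) x y =
    (if v \<le> N ^ c \<and> ok N x y then e3 N (v, d1 N x, d2 N y) else [])" for N v r x y
  \<comment> \<open>Identifiers are part of the messages, so on well-formed certificates the choice
    in \<open>look\<close> is unambiguous. The node's own certificates reach it directly, not by
    message.\<close>
  define dec where "dec N v r x y M \<longleftrightarrow> ok N x y \<and>
    (let R = d3 N ` set_mset M;
         look = (\<lambda>u. SOME t. (u, t) \<in> R);
         a = (\<lambda>u. if u = v then d1 N x else fst (look u));
         b = (\<lambda>u. if u = v then d2 N y else snd (look u))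
     in ?Q N (\<phi> N r) v (fst ` R) a b)" for N v r x y M
  have d1_in: "d1 N x \<in> ?T1 N" if "ok N x y" for N x y
    using that unfolding ok_def d1_def by (blast intro: inv_into_into)
  have d2_in: "d2 N y \<in> ?T2 N" if "ok N x y" for N x y
    using that unfolding ok_def d2_def by (blast intro: inv_into_into)

  have dec_iff: "dec N v r (c1 v) (c2 r v)
       (image_mset (\<lambda>u. msg N u r (c1 u) (c2 r u)) (mset_set {u\<in>V. E v u})) \<longleftrightarrow>
     ?Q N (\<phi> N r) v {u\<in>V. E v u} (\<lambda>u. d1 N (c1 u)) (\<lambda>u. d2 N (c2 r u))"
    if val: "valid_config c V E" and N: "card V \<le> N" and v: "v \<in> V"
      and okV: "\<forall>u\<in>V. ok N (c1 u) (c2 r u)" for V E N v r c1 c2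
  proof -
    let ?S = "{u\<in>V. E v u}"
    let ?M = "image_mset (\<lambda>u. msg N u r (c1 u) (c2 r u)) (mset_set ?S)"
    have fin: "finite ?S" using val by (auto simp: valid_config_def)
    have id_le: "u \<le> N ^ c" if "u \<in> V" for u
    proof -
      have "u \<le> card V ^ c" using val that by (auto simp: valid_config_def)
      also have "\<dots> \<le> N ^ c" using N by (intro power_mono) auto
      finally show ?thesis .
    qed
    have d3m: "d3 N (msg N u r (c1 u) (c2 r u)) = (u, d1 N (c1 u), d2 N (c2 r u))" if "u \<in> V" for u
    proof -
      have "(u, d1 N (c1 u), d2 N (c2 r u)) \<in> T3 N"
        using id_le[OF that] d1_in[OF bspec[OF okV that]] d2_in[OF bspec[OF okV that]] by (simp add: T3_def)
      then show ?thesis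
        using id_le[OF that] bspec[OF okV that] by (simp add: msg_def d3_def inv_into_f_f[OF e3(1)])
    qed
    define R where "R = (\<lambda>u. (u, d1 N (c1 u), d2 N (c2 r u))) ` ?S"
    have R: "d3 N ` set_mset ?M = R"
      unfolding R_def using fin by (auto simp: image_image d3m intro!: image_cong)
    have S: "fst ` R = ?S" by (force simp: R_def)
    have look: "(SOME t. (u, t) \<in> R) = (d1 N (c1 u), d2 N (c2 r u))" if "u \<in> ?S" for u
      using that by (intro some_equality) (auto simp: R_def)
    show ?thesis
      unfolding dec_def Let_def R S using bspec[OF okV v]
      by (auto elim!: cong[rotated] simp: look)
  qed

  show "\<exists>(k::real) L msg dec. \<forall>V E N. valid_config c V E \<and> card V \<le> N \<and> N \<le> card V ^ c \<longrightarrow>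
          (\<forall>v\<in>V. \<forall>r x y. short k (card V) x \<longrightarrow> short k (card V) y \<longrightarrow>
                short k (card V) (msg N v r x y)) \<and>
          (P V E \<longrightarrow> (\<exists>c1 c2. prover_ok k (card V) V c1 c2 \<and>
                prob_bits (L N) (all_accept msg dec N V E c1 c2) \<ge> 2/3)) \<and>
          (\<not> P V E \<longrightarrow> (\<forall>c1 c2. prover_ok k (card V) V c1 c2 \<longrightarrow>
                prob_bits (L N) (\<lambda>r. \<not> all_accept msg dec N V E c1 c2 r) \<ge> 2/3))"
  proof (rule exI[of _ k], rule exI[of _ L], rule exI[of _ msg], rule exI[of _ dec],
      intro allI impI conjI ballI; (elim conjE)?)
    fix V E N v r x y
    assume val: "valid_config c V E" and N: "card V \<le> N" "N \<le> card V ^ c"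
    show "short k (card V) (msg N v r x y)"
    proof (rule short_m[OF val N])
      show "length (msg N v r x y) \<le> m N"
        using d1_in[of N x y] d2_in[of N x y] by (auto simp: msg_def T3_def intro!: eq_refl e3(2))
    qed
  next
    fix V E N
    assume val: "valid_config c V E" and N: "card V \<le> N" "N \<le> card V ^ c" and "P V E"
    from complete[OF val N(1) this(4)] obtain a b where
      a: "\<And>v. v \<in> V \<Longrightarrow> a v \<in> ?T1 N" and
      b: "\<And>\<omega> v. \<omega> \<in> ?\<Omega> N \<Longrightarrow> v \<in> V \<Longrightarrow> b \<omega> v \<in> ?T2 N" and
      Q: "\<And>\<omega> v. \<omega> \<in> ?\<Omega> N \<Longrightarrow> v \<in> V \<Longrightarrow> ?Q N \<omega> v {u\<in>V. E v u} a (b \<omega>)" by metis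
    define c1 where "c1 v = e1 N (a v)" for v
    \<comment> \<open>\<open>prover_ok\<close> bounds the certificates for strings \<open>r\<close>
      of every length; where \<open>\<phi>\<close> does not yield a valid outcome, the empty string
      is a short default.\<close>
    define c2 where "c2 r v = (if \<phi> N r \<in> ?\<Omega> N then e2 N (b (\<phi> N r) v) else [])" for r v
    have "prover_ok k (card V) V c1 c2"
      unfolding prover_ok_def
      by (auto intro!: short_m[OF val N] simp: c1_def c2_def e1(2)[OF a] e2(2)[OF b])
    moreover have "all_accept msg dec N V E c1 c2 r" if "length r = L N" for r
      unfolding all_accept_def
    proof
      fix v assume v: "v \<in> V"
      have \<omega>: "\<phi> N r \<in> ?\<Omega> N" using bij_betwE[OF \<phi>] that by blast
      have okV: "\<forall>u\<in>V. ok N (c1 u) (c2 r u)"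
        using a b \<omega> by (auto simp: ok_def c1_def c2_def)
      have dd: "d1 N (c1 u) = a u" "d2 N (c2 r u) = b (\<phi> N r) u" if "u \<in> V" for u
        using a b \<omega> that by (auto simp: d1_def d2_def c1_def c2_def inv_into_f_f e1(1) e2(1))
      show "dec N v r (c1 v) (c2 r v)
          (image_mset (\<lambda>u. msg N u r (c1 u) (c2 r u)) (mset_set {u\<in>V. E v u}))"
        unfolding dec_iff[where r = r and ?c1.0 = c1 and ?c2.0 = c2, OF val N(1) v okV]
        by (rule cong[OF _ Q[OF \<omega> v]]) (use v dd in auto)
    qed
    then have "{r. length r = L N \<and> all_accept msg dec N V E c1 c2 r} = {r. length r = L N}" by blast
    then have "prob_bits (L N) (all_accept msg dec N V E c1 c2) = 1"
      by (simp add: prob_bits_def card_bit_lists)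
    ultimately show "\<exists>c1 c2. prover_ok k (card V) V c1 c2 \<and>
        prob_bits (L N) (all_accept msg dec N V E c1 c2) \<ge> 2/3"
      by (intro exI[of _ c1] exI[of _ c2]) simp
  next
    fix V E N c1 c2
    assume val: "valid_config c V E" and N: "card V \<le> N" and nP: "\<not> P V E"
    let ?A = "{r. length r = L N \<and> all_accept msg dec N V E c1 c2 r}"
    have "3 * card ?A \<le> 2 ^ L N"
    proof (cases "\<forall>v\<in>V. c1 v \<in> e1 N ` ?T1 N")
      case False
      then have "?A = {}" by (auto simp: all_accept_def dec_def ok_def)
      then show ?thesis by (metis card.empty mult_0_right zero_le)
    next
      case True
      let ?B = "{\<omega>\<in>?\<Omega> N. \<exists>b. (\<forall>v\<in>V. b v \<in> ?T2 N) \<and>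
        (\<forall>v\<in>V. ?Q N \<omega> v {u\<in>V. E v u} (\<lambda>u. d1 N (c1 u)) b)}"
      have fin: "finite (?\<Omega> N)" using L[of N] by (metis card.infinite power_not_zero zero_neq_numeral)
      \<comment> \<open>The decoded second certificates for \<open>r\<close> are the witness for
        \<open>b\<close>.\<close>
      have "\<phi> N ` ?A \<subseteq> ?B"
      proof safe
        fix r assume r: "length r = L N" and acc: "all_accept msg dec N V E c1 c2 r"
        show "\<phi> N r \<in> ?\<Omega> N" using bij_betwE[OF \<phi>] r by blast
        have okV: "\<forall>u\<in>V. ok N (c1 u) (c2 r u)"
          using acc by (auto simp: all_accept_def dec_def)
        have "?Q N (\<phi> N r) v {u\<in>V. E v u} (\<lambda>u. d1 N (c1 u)) (\<lambda>u. d2 N (c2 r u))" if "v \<in> V" for v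
          by (rule iffD1[OF dec_iff[where r = r and ?c1.0 = c1 and ?c2.0 = c2, OF val N that okV]])
             (rule bspec[OF acc[unfolded all_accept_def] that])
        then show "\<exists>b. (\<forall>v\<in>V. b v \<in> ?T2 N) \<and>
          (\<forall>v\<in>V. ?Q N (\<phi> N r) v {u\<in>V. E v u} (\<lambda>u. d1 N (c1 u)) b)"
          using d2_in[OF bspec[OF okV]] by (intro exI[of _ "\<lambda>u. d2 N (c2 r u)"] conjI ballI)
      qed
      moreover have "inj_on (\<phi> N) ?A"
        by (rule inj_on_subset[OF bij_betw_imp_inj_on[OF \<phi>]]) auto
      ultimately have "card ?A \<le> card ?B" using fin by (intro card_inj_on_le) auto
      moreover have "\<forall>v\<in>V. d1 N (c1 v) \<in> ?T1 N"
        using True unfolding d1_def by (blast intro: inv_into_into)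
      note sound[OF val N nP this]
      ultimately show ?thesis by (simp add: L)
    qed
    then have "real (3 * card ?A) \<le> real (2 ^ L N)" by (simp only: of_nat_le_iff)
    then have "prob_bits (L N) (all_accept msg dec N V E c1 c2) \<le> 1 / 3"
      by (simp add: prob_bits_def field_simps)
    then show "prob_bits (L N) (\<lambda>r. \<not> all_accept msg dec N V E c1 c2 r) \<ge> 2/3"
      by (simp add: prob_bits_not)
  qed
qed

subsection \<open>Adding up along a spanning tree\<close>

text \<open>A derivation builds a spanning tree of the set leaf by leaf, which is the induction that
  subtree sums need.\<close>

inductive grown :: "('a \<Rightarrow> 'a \<Rightarrow> bool) \<Rightarrow> 'a \<Rightarrow> 'a set \<Rightarrow> bool" for E \<rho> where
  root: "grown E \<rho> {\<rho>}"
| step: "grown E \<rho> S \<Longrightarrow> v \<in> S \<Longrightarrow> u \<notin> S \<Longrightarrow> E v u \<Longrightarrow> grown E \<rho> (insert u S)"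

text \<open>A maximal grown subset of \<open>V\<close> is closed under adjacency, since a neighbour
  outside could still be attached; connectedness then makes it all of \<open>V\<close>.\<close>

lemma grown_connected:
  assumes fin: "finite V" and \<rho>: "\<rho> \<in> V" and EV: "\<And>u v. E u v \<Longrightarrow> v \<in> V"
    and conn: "\<And>v. v \<in> V \<Longrightarrow> E\<^sup>*\<^sup>* \<rho> v"
  shows "grown E \<rho> V"
proof -
  let ?F = "{S. grown E \<rho> S \<and> S \<subseteq> V}"
  have "finite ?F" using fin by simp
  moreover have "?F \<noteq> {}" using \<rho> grown.root[of E \<rho>] by blast
  ultimately obtain S where S: "S \<in> ?F" and max: "\<forall>T\<in>?F. S \<subseteq> T \<longrightarrow> S = T"
    by (rule bexE[OF finite_has_maximal])
  have \<rho>S: "\<rho> \<in> S" if "grown E \<rho> S" for S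
    using that by induction auto
  have closed: "u \<in> S" if "v \<in> S" "E v u" for u v
  proof (rule ccontr)
    assume u: "u \<notin> S"
    then have "insert u S \<in> ?F" using S EV that by (auto intro: grown.step)
    then show False using max u by blast
  qed
  have "v \<in> S" if "E\<^sup>*\<^sup>* \<rho> v" for v
    using that
  proof induction
    case base
    show ?case using \<rho>S S by blast
  next
    case (step y z)
    show ?case by (rule closed[OF step.IH step.hyps(2)])
  qed
  then have "S = V" using S conn by blast
  then show ?thesis using S by simp
qed

text \<open>\<open>s\<close> collects the subtree sums of \<open>f\<close>. The bound on
  \<open>\<bar>s v\<bar>\<close> is what keeps the second certificates logarithmic.\<close>

definition aggregates :: "('a \<Rightarrow> 'a \<Rightarrow> bool) \<Rightarrow> 'a \<Rightarrow> 'a set \<Rightarrow> ('a \<Rightarrow> 'a) \<Rightarrow> ('a \<Rightarrow> int) \<Rightarrow> ('a \<Rightarrow> int) \<Rightarrow> bool" where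
  "aggregates E \<rho> S par f s \<longleftrightarrow>
     (\<forall>u\<in>S. u \<noteq> \<rho> \<longrightarrow> par u \<in> S \<and> E (par u) u) \<and>
     (\<forall>v\<in>S. s v = f v + (\<Sum>u | u \<in> S \<and> u \<noteq> \<rho> \<and> par u = v. s u)) \<and>
     s \<rho> = (\<Sum>u\<in>S. f u) \<and> (\<forall>v\<in>S. \<bar>s v\<bar> \<le> (\<Sum>u\<in>S. \<bar>f u\<bar>))"

text \<open>The order of quantifiers follows the interaction: the tree is sent before the weights
  are known, so \<open>par\<close> must serve every \<open>f\<close>, and only \<open>s\<close> may
  depend on it.\<close>

lemma aggregates_exist:
  assumes "grown E \<rho> S"
  shows "\<exists>par. \<forall>f. \<exists>s. aggregates E \<rho> S par f s"
  using assms
proof induction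
  case root
  have "{u. u = \<rho> \<and> u \<noteq> \<rho> \<and> P u} = {}" for P by auto
  then have "aggregates E \<rho> {\<rho>} (\<lambda>_. \<rho>) f f" for f by (simp add: aggregates_def)
  then show ?case by blast
next
  case (step S v u)
  note hyp = step.hyps(2-4)
  have fin: "finite S" using step.hyps(1) by induction auto
  have \<rho>S: "\<rho> \<in> S" using step.hyps(1) by induction auto
  from step.IH obtain par where IH: "\<And>f. \<exists>s. aggregates E \<rho> S par f s" by blast
  let ?par = "par(u := v)"
  have "\<exists>s. aggregates E \<rho> (insert u S) ?par f s" for f
  proof -
    \<comment> \<open>Folding the value of the new leaf \<open>u\<close> into its parent
      \<open>v\<close> reduces to the smaller tree; its sums remain correct on \<open>S\<close> once
      \<open>u\<close> is split off again.\<close>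
    let ?f = "f(v := f v + f u)"
    from IH[of ?f] obtain s where
      "\<forall>x\<in>S. x \<noteq> \<rho> \<longrightarrow> par x \<in> S \<and> E (par x) x"
      "\<forall>x\<in>S. s x = ?f x + (\<Sum>y | y \<in> S \<and> y \<noteq> \<rho> \<and> par y = x. s y)"
      and s\<rho>: "s \<rho> = (\<Sum>x\<in>S. ?f x)" and "\<forall>x\<in>S. \<bar>s x\<bar> \<le> (\<Sum>y\<in>S. \<bar>?f y\<bar>)"
      unfolding aggregates_def by (elim exE conjE)
    note par = this(1)[rule_format] and s = bspec[OF this(2)] and le = bspec[OF this(4)]
    let ?s = "s(u := f u)"
    have u\<rho>: "u \<noteq> \<rho>" using \<rho>S hyp by auto
    have total: "(\<Sum>x\<in>S. ?f x) = (\<Sum>x\<in>insert u S. f x)"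
    proof -
      have "(\<Sum>x\<in>S. ?f x) = (f v + f u) + (\<Sum>x\<in>S - {v}. f x)"
        using fin hyp by (subst sum.remove[of _ v]) auto
      also have "\<dots> = f u + (\<Sum>x\<in>S. f x)"
        using fin hyp by (subst (2) sum.remove[of _ v]) auto
      finally show ?thesis using fin hyp by simp
    qed
    have abs: "(\<Sum>x\<in>S. \<bar>?f x\<bar>) \<le> (\<Sum>x\<in>insert u S. \<bar>f x\<bar>)"
    proof -
      have "(\<Sum>x\<in>S. \<bar>?f x\<bar>) = \<bar>f v + f u\<bar> + (\<Sum>x\<in>S - {v}. \<bar>f x\<bar>)"
        using fin hyp by (subst sum.remove[of _ v]) auto
      also have "\<dots> \<le> \<bar>f u\<bar> + (\<Sum>x\<in>S. \<bar>f x\<bar>)"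
        using fin hyp by (subst (2) sum.remove[of _ v]) auto
      finally show ?thesis using fin hyp by simp
    qed
    have children: "{y. y \<in> insert u S \<and> y \<noteq> \<rho> \<and> ?par y = x} =
        (if x = v then insert u else id) {y. y \<in> S \<and> y \<noteq> \<rho> \<and> par y = x}" for x
      using hyp u\<rho> by auto
    have no_child: "{y. y \<in> S \<and> y \<noteq> \<rho> \<and> par y = u} = {}"
      using par hyp by auto
    have same: "(\<Sum>y | y \<in> S \<and> y \<noteq> \<rho> \<and> par y = x. ?s y) = (\<Sum>y | y \<in> S \<and> y \<noteq> \<rho> \<and> par y = x. s y)" for x
      using hyp by (intro sum.cong) auto
    have eq: "?s x = f x + (\<Sum>y | y \<in> insert u S \<and> y \<noteq> \<rho> \<and> ?par y = x. ?s y)" if x: "x \<in> insert u S" for x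
    proof -
      consider "x = u" | "x = v" | "x \<in> S" "x \<noteq> v" using x by blast
      then show ?thesis
      proof cases
        case 1
        then have "x \<noteq> v" using hyp by auto
        then show ?thesis using 1 unfolding children by (simp add: no_child)
      next
        case 2
        have "finite {y. y \<in> S \<and> y \<noteq> \<rho> \<and> par y = v}" using fin by simp
        then have "(\<Sum>y\<in>insert u {y. y \<in> S \<and> y \<noteq> \<rho> \<and> par y = v}. ?s y) =
            f u + (\<Sum>y | y \<in> S \<and> y \<noteq> \<rho> \<and> par y = v. s y)"
          using hyp same[of v] by (subst sum.insert) auto
        moreover have "?s v = f v + f u + (\<Sum>y | y \<in> S \<and> y \<noteq> \<rho> \<and> par y = v. s y)"
          using s[of v] hyp by auto
        ultimately show ?thesis unfolding 2 children by simp
      next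
        case 3
        then have "?s x = f x + (\<Sum>y | y \<in> S \<and> y \<noteq> \<rho> \<and> par y = x. s y)"
          using s[of x] hyp by auto
        then show ?thesis using 3 same[of x] unfolding children by simp
      qed
    qed
    show ?thesis
      unfolding aggregates_def
    proof (intro exI[of _ ?s] conjI ballI)
      fix x assume "x \<in> insert u S"
      then show "\<bar>?s x\<bar> \<le> (\<Sum>y\<in>insert u S. \<bar>f y\<bar>)"
        using abs le[of x] hyp fin by (auto simp: sum_nonneg)
      show "?s x = f x + (\<Sum>y | y \<in> insert u S \<and> y \<noteq> \<rho> \<and> ?par y = x. ?s y)" by (rule eq) fact
    next
      show "?s \<rho> = (\<Sum>x\<in>insert u S. f x)" using u\<rho> s\<rho> total by simp
    qed (use par hyp in auto)
  qed
  then show ?case by blast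
qed

text \<open>The parent pointers need not be acyclic: every node other than \<open>\<rho>\<close> is counted exactly once as a child.\<close>

lemma parent_sums_root:
  fixes f s :: "'a \<Rightarrow> int"
  assumes fin: "finite V"
    and par: "\<And>u. u \<in> V \<Longrightarrow> u \<noteq> \<rho> \<Longrightarrow> par u \<in> V"
    and s: "\<And>v. v \<in> V \<Longrightarrow> s v = f v + (\<Sum>u | u \<in> V \<and> u \<noteq> \<rho> \<and> par u = v. s u)"
    and \<rho>: "\<rho> \<in> V \<Longrightarrow> s \<rho> = 0"
  shows "(\<Sum>v\<in>V. f v) = 0"
proof -
  have "(\<Sum>v\<in>V. s v) = (\<Sum>v\<in>V. f v + (\<Sum>u | u \<in> V \<and> u \<noteq> \<rho> \<and> par u = v. s u))"
    by (rule sum.cong[OF refl s])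
  also have "\<dots> = (\<Sum>v\<in>V. f v) + (\<Sum>v\<in>V. \<Sum>u | u \<in> V - {\<rho>} \<and> par u = v. s u)"
    by (simp add: sum.distrib)
  also have "(\<Sum>v\<in>V. \<Sum>u | u \<in> V - {\<rho>} \<and> par u = v. s u) = (\<Sum>u\<in>V - {\<rho>}. s u)"
    by (rule sum.group) (use fin par in auto)
  also have "(\<Sum>u\<in>V - {\<rho>}. s u) = (\<Sum>u\<in>V. s u)"
    using fin \<rho> by (cases "\<rho> \<in> V") (auto simp: sum_diff1)
  finally show ?thesis by simp
qed

subsection \<open>Random weights\<close>

text \<open>With all other weights fixed, at most one of the four values of \<open>w i\<close> makes
  the form vanish, so forgetting \<open>w i\<close> is injective on the zeros.\<close>

lemma zero_sum_count:
  fixes g :: "'i \<Rightarrow> int"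
  assumes fin: "finite I" and i: "i \<in> I" "g i \<noteq> 0"
  shows "4 * card {w \<in> I \<rightarrow>\<^sub>E {0..3}. (\<Sum>j\<in>I. g j * w j) = 0} \<le> card (I \<rightarrow>\<^sub>E {0..3 :: int})"
proof -
  let ?Z = "{w \<in> I \<rightarrow>\<^sub>E {0..3}. (\<Sum>j\<in>I. g j * w j) = 0}"
  let ?R = "\<lambda>w. restrict w (I - {i})"
  have "inj_on ?R ?Z"
  proof (rule inj_onI)
    fix w w' assume w: "w \<in> ?Z" and w': "w' \<in> ?Z" and eq: "?R w = ?R w'"
    have same: "w j = w' j" if "j \<in> I - {i}" for j
      using fun_cong[OF eq, of j] that by simp
    have "(\<Sum>j\<in>I. g j * w j) = g i * w i + (\<Sum>j\<in>I - {i}. g j * w j)"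
      "(\<Sum>j\<in>I. g j * w' j) = g i * w' i + (\<Sum>j\<in>I - {i}. g j * w' j)"
      using fin i by (auto simp: sum.remove)
    moreover have "(\<Sum>j\<in>I - {i}. g j * w j) = (\<Sum>j\<in>I - {i}. g j * w' j)"
      using same by (intro sum.cong) auto
    ultimately have "g i * w i = g i * w' i" using w w' by (simp only: mem_Collect_eq) linarith
    then have "w i = w' i" using i by simp
    then show "w = w'"
      using w w' same by (intro PiE_ext[of w I "\<lambda>_. {0..3}" w']) auto
  qed
  moreover have "?R ` ?Z \<subseteq> (I - {i}) \<rightarrow>\<^sub>E {0..3}"
    by (intro image_subsetI restrict_PiE_iff[THEN iffD2]) auto
  moreover have "finite ((I - {i}) \<rightarrow>\<^sub>E {0..3 :: int})" using fin by (intro finite_PiE) auto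
  ultimately have "card ?Z \<le> card ((I - {i}) \<rightarrow>\<^sub>E {0..3 :: int})" by (rule card_inj_on_le)
  also have "\<dots> = 4 ^ (card I - 1)" using fin i by (simp add: card_PiE)
  finally have "4 * card ?Z \<le> 4 ^ Suc (card I - 1)" by simp
  also have "Suc (card I - 1) = card I" using fin i by (metis card_Diff_singleton card_Suc_Diff1)
  finally show ?thesis using fin by (simp add: card_PiE)
qed

text \<open>Turns a sum of weights over edges into a linear form whose coefficients do not depend on
  the weights, as \<open>zero_sum_count\<close> requires.\<close>

lemma sum_by_fibres:
  fixes w :: "'i \<Rightarrow> int"
  assumes "finite D" "finite I" "h ` D \<subseteq> I"
  shows "(\<Sum>e\<in>D. w (h e)) = (\<Sum>i\<in>I. int (card {e\<in>D. h e = i}) * w i)"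
proof -
  have "(\<Sum>e\<in>D. w (h e)) = (\<Sum>i\<in>I. \<Sum>e | e \<in> D \<and> h e = i. w (h e))"
    by (rule sum.group[symmetric]) (use assms in auto)
  also have "\<dots> = (\<Sum>i\<in>I. int (card {e\<in>D. h e = i}) * w i)"
    by (intro sum.cong) auto
  finally show ?thesis .
qed

subsection \<open>Lattice paths\<close>

definition step :: "bool \<Rightarrow> nat \<times> nat \<Rightarrow> nat \<times> nat" where
  "step b p = (if b then (fst p + 1, snd p) else (fst p, snd p + 1))"

definition lev :: "nat \<times> nat \<Rightarrow> nat" where "lev p = fst p + snd p"

lemma lev_step [simp]: "lev (step b p) = lev p + 1"
  by (simp add: lev_def step_def)

lemma step_neq_origin [simp]: "step b p \<noteq> (0, 0)"
  by (simp add: step_def)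

text \<open>Since a step raises the level by one, at most one unit of flow leaves the origin and at most one
  crosses each level, so the edges form a single monotone path.\<close>

lemma lattice_flow:
  fixes src :: "'e \<Rightarrow> nat \<times> nat" and op :: "'e \<Rightarrow> bool"
  assumes fin: "finite D"
    and flow: "\<And>q. card {e\<in>D. src e = q} \<le> card {e\<in>D. step (op e) (src e) = q} + of_bool (q = (0, 0))"
  defines "\<sigma> \<equiv> \<lambda>p. (card {e\<in>D. op e \<and> lev (src e) < p}, card {e\<in>D. \<not> op e \<and> lev (src e) < p})"
  shows "inj_on (lev \<circ> src) D" "\<And>e. e \<in> D \<Longrightarrow> src e = \<sigma> (lev (src e))"
proof -
  \<comment> \<open>The two claims need each other: uniqueness at one level identifies the step
    leading to the next, and the common starting point there yields uniqueness again.\<close>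
  have main: "(\<forall>e\<in>D. lev (src e) = p \<longrightarrow> src e = \<sigma> p) \<and> card {e\<in>D. lev (src e) = p} \<le> 1" for p
  proof (induction p)
    case 0
    have "card {e\<in>D. src e = (0, 0)} \<le> 1"
      using flow[of "(0, 0)"] by simp
    moreover have "lev q = 0 \<longleftrightarrow> q = (0, 0)" for q by (cases q) (simp add: lev_def)
    ultimately show ?case by (simp add: \<sigma>_def)
  next
    case (Suc p)
    have src: "src e = \<sigma> (Suc p)" if e: "e \<in> D" "lev (src e) = Suc p" for e
    proof -
      \<comment> \<open>Away from the origin there is no source term, so the edge has a predecessor
        one level below.\<close>
      have "src e \<noteq> (0, 0)" using e by (auto simp: lev_def)
      moreover have "card {e'\<in>D. src e' = src e} > 0" using e fin by (auto simp: card_gt_0_iff)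
      ultimately have "card {e'\<in>D. step (op e') (src e') = src e} > 0"
        using flow[of "src e"] by simp
      then obtain e' where e': "e' \<in> D" "step (op e') (src e') = src e"
        by (auto simp: card_gt_0_iff)
      have p: "lev (src e') = p" using e' e lev_step[of "op e'" "src e'"] by simp
      have uniq: "e'' = e'" if "e'' \<in> D" "lev (src e'') = p" for e''
      proof -
        have "finite {e\<in>D. lev (src e) = p}" using fin by simp
        then show ?thesis
          using Suc.IH p e' that card_le_Suc0_iff_eq[of "{e\<in>D. lev (src e) = p}"] by auto
      qed
      have split: "{x\<in>D. P x \<and> lev (src x) < Suc p} =
          {x\<in>D. P x \<and> lev (src x) < p} \<union> (if P e' then {e'} else {})" for P
        using e' p by (auto simp: less_Suc_eq dest: uniq)
      have "\<sigma> (Suc p) = step (op e') (\<sigma> p)"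
        using fin p unfolding \<sigma>_def split by (cases "op e'") (simp_all add: step_def)
      then show ?thesis using e' Suc.IH p by simp
    qed
    have "card {e\<in>D. lev (src e) = Suc p} \<le> 1"
    proof (cases "{e\<in>D. lev (src e) = Suc p} = {}")
      case False
      then have lev: "lev (\<sigma> (Suc p)) = Suc p" using src by force
      \<comment> \<open>All edges of this level leave one point, whose inflow comes from the at most
        one edge of the level below.\<close>
      have "card {e\<in>D. lev (src e) = Suc p} \<le> card {e\<in>D. src e = \<sigma> (Suc p)}"
        using src fin by (intro card_mono) auto
      also have "\<dots> \<le> card {e\<in>D. step (op e) (src e) = \<sigma> (Suc p)}"
        using flow[of "\<sigma> (Suc p)"] lev lev_def[of "(0, 0)"] by (cases "\<sigma> (Suc p) = (0, 0)") simp_all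
      also have "\<dots> \<le> card {e\<in>D. lev (src e) = p}"
      proof (intro card_mono)
        show "{e\<in>D. step (op e) (src e) = \<sigma> (Suc p)} \<subseteq> {e\<in>D. lev (src e) = p}"
        proof safe
          fix e assume "step (op e) (src e) = \<sigma> (Suc p)"
          then show "lev (src e) = p" using lev lev_step[of "op e" "src e"] by simp
        qed
      qed (use fin in auto)
      finally show ?thesis using Suc.IH by simp
    next
      case True
      show ?thesis unfolding True by simp
    qed
    then show ?case using src by blast
  qed
  show "inj_on (lev \<circ> src) D"
  proof (rule inj_onI)
    fix e e' assume "e \<in> D" "e' \<in> D" "(lev \<circ> src) e = (lev \<circ> src) e'"
    then show "e = e'"
      using main[of "lev (src e)"] fin card_le_Suc0_iff_eq[of "{x\<in>D. lev (src x) = lev (src e)}"] by auto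
  qed
  show "src e = \<sigma> (lev (src e))" if "e \<in> D" for e using main that by blast
qed

subsection \<open>Chord diagrams\<close>

text \<open>\<open>P (v, True)\<close> and \<open>P (v, False)\<close> are the left and right endpoints of the chord of \<open>v\<close>, after cutting
  the circle open.\<close>

definition overlap :: "(nat \<times> bool \<Rightarrow> nat) \<Rightarrow> nat \<Rightarrow> nat \<Rightarrow> bool" where
  "overlap P u v \<longleftrightarrow> P (u, True) < P (v, True) \<and> P (v, True) < P (u, False) \<and> P (u, False) < P (v, False)"

definition chord_ends :: "nat set \<Rightarrow> (nat \<times> bool \<Rightarrow> nat) \<Rightarrow> bool" where
  "chord_ends V P \<longleftrightarrow> inj_on P (V \<times> UNIV) \<and> (\<forall>v\<in>V. P (v, True) < P (v, False))"

definition chord_diagram :: "nat set \<Rightarrow> (nat \<Rightarrow> nat \<Rightarrow> bool) \<Rightarrow> (nat \<times> bool \<Rightarrow> nat) \<Rightarrow> bool" where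
  "chord_diagram V E P \<longleftrightarrow> chord_ends V P \<and>
     (\<forall>u\<in>V. \<forall>v\<in>V. u \<noteq> v \<longrightarrow> (E u v \<longleftrightarrow> overlap P u v \<or> overlap P v u))"

text \<open>A chord nested inside that of \<open>v\<close> has one endpoint of each kind between the
  ends of \<open>v\<close> and cancels; a chord around or beside it has none there. The 1 discounts
  the left endpoint of \<open>v\<close> itself.\<close>

lemma overlap_balance:
  assumes fin: "finite V" and ends: "chord_ends V P" and v: "v \<in> V"
  shows "int (card {u\<in>V. overlap P u v}) - int (card {u\<in>V. overlap P v u}) =
    (int (card {u\<in>V. P (u, False) < P (v, False)}) - int (card {u\<in>V. P (u, False) < P (v, True)})) -
    (int (card {u\<in>V. P (u, True) < P (v, False)}) - int (card {u\<in>V. P (u, True) < P (v, True)}) - 1)"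
proof -
  have count: "int (card {u\<in>V. Q u}) = (\<Sum>u\<in>V. of_bool (Q u))" for Q
    using fin by (simp add: of_bool_def sum.If_cases Int_def)
  have one: "(1 :: int) = (\<Sum>u\<in>V. of_bool (u = v))"
    using fin v by (simp add: of_bool_def)
  have pointwise: "of_bool (overlap P u v) - of_bool (overlap P v u) =
      ((of_bool (P (u, False) < P (v, False)) - of_bool (P (u, False) < P (v, True))) -
       (of_bool (P (u, True) < P (v, False)) - of_bool (P (u, True) < P (v, True)) - of_bool (u = v)) :: int)"
    if u: "u \<in> V" for u
  proof -
    have lt: "P (u, True) < P (u, False)" "P (v, True) < P (v, False)"
      using ends u v by (auto simp: chord_ends_def)
    show ?thesis
    proof (cases "u = v")
      case True
      then show ?thesis using lt by (simp add: overlap_def)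
    next
      case False
      then have "P (u, b) \<noteq> P (v, b')" for b b'
        using ends u v by (auto simp: chord_ends_def dest: inj_onD)
      from this[of True True] this[of True False] this[of False True] this[of False False]
      show ?thesis using lt False unfolding overlap_def by (auto simp: of_bool_def)
    qed
  qed
  show ?thesis
    unfolding count one sum_subtractf[symmetric] by (rule sum.cong[OF refl pointwise])
qed

text \<open>Scanning chords by left endpoint, all overlaps from the left are already known to be edges, so
  equality of the differences forces equality of the number of overlaps to the right.\<close>

lemma all_overlaps_adjacent:
  assumes fin: "finite V" and EV: "\<And>u v. E u v \<Longrightarrow> u \<in> V \<and> v \<in> V" and sym: "\<And>u v. E u v \<Longrightarrow> E v u"
    and cross: "\<And>u v. E u v \<Longrightarrow> overlap P u v \<or> overlap P v u"
    and balance: "\<And>v. v \<in> V \<Longrightarrow>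
      int (card {u\<in>V. E v u \<and> P (u, True) < P (v, True)}) -
      int (card {u\<in>V. E v u \<and> P (v, True) < P (u, True)}) =
      int (card {u\<in>V. overlap P u v}) - int (card {u\<in>V. overlap P v u})"
  shows "v \<in> V \<Longrightarrow> u \<in> V \<Longrightarrow> overlap P v u \<Longrightarrow> E v u"
proof (induction "P (v, True)" arbitrary: v u rule: less_induct)
  case less
  let ?L = "{u\<in>V. E v u \<and> P (u, True) < P (v, True)}" and ?R = "{u\<in>V. E v u \<and> P (v, True) < P (u, True)}"
  have "?L \<subseteq> {u\<in>V. overlap P u v}" using cross by (fastforce simp: overlap_def)
  moreover have "{u\<in>V. overlap P u v} \<subseteq> ?L"
  proof safe
    fix x assume x: "x \<in> V" "overlap P x v"
    then show "P (x, True) < P (v, True)" by (simp add: overlap_def)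
    from less.hyps[OF this x(1) less.prems(1) x(2)] show "E v x" by (rule sym)
  qed
  ultimately have "?L = {u\<in>V. overlap P u v}" by blast
  then have "card ?R = card {u\<in>V. overlap P v u}" using balance[OF less.prems(1)] by simp
  moreover have "?R \<subseteq> {u\<in>V. overlap P v u}" using cross by (fastforce simp: overlap_def)
  ultimately have "?R = {u\<in>V. overlap P v u}" using fin by (intro card_subset_eq) auto
  then show ?case using less.prems by blast
qed

subsection \<open>Chords of the unit circle\<close>

text \<open>Signed distance from the line through \<open>cis a\<close> and \<open>cis b\<close>:
  rotating by the mean angle makes the chord vertical with abscissa
  \<open>cos ((b - a) / 2)\<close>.\<close>

definition chord_side :: "real \<Rightarrow> real \<Rightarrow> complex \<Rightarrow> real" where
  "chord_side a b z = Re (z * cis (- ((a + b) / 2))) - cos ((b - a) / 2)"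

text \<open>For angles in \<open>[0, 2 * pi)\<close> the half differences lie strictly between
  \<open>- pi\<close> and \<open>pi\<close>, so each factor has the sign of its argument and sides
  are decided by comparing angles.\<close>

lemma chord_side_cis: "chord_side a b (cis t) = 2 * sin ((t - a) / 2) * sin ((b - t) / 2)"
proof -
  have "chord_side a b (cis t) = cos (t - (a + b) / 2) - cos ((b - a) / 2)"
    by (simp add: chord_side_def cis_mult)
  also have "\<dots> = 2 * sin ((t - a) / 2) * sin ((b - t) / 2)"
  proof -
    have "(t - (a + b) / 2 + (b - a) / 2) / 2 = (t - a) / 2" "((b - a) / 2 - (t - (a + b) / 2)) / 2 = (b - t) / 2"
      by (simp_all add: field_simps)
    then show ?thesis unfolding cos_diff_cos by (simp only:)
  qed
  finally show ?thesis .
qed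

lemma chord_side_affine:
  "chord_side a b ((1 - u) *\<^sub>R x + u *\<^sub>R y) = (1 - u) * chord_side a b x + u * chord_side a b y"
  by (simp add: chord_side_def algebra_simps)

lemma chord_side_inside:
  assumes "0 \<le> a" "a < t" "t < b" "b < 2 * pi"
  shows "chord_side a b (cis t) > 0"
  unfolding chord_side_cis using assms by (intro mult_pos_pos sin_gt_zero) auto

lemma chord_side_outside:
  assumes "0 \<le> a" "a < b" "b < 2 * pi" "0 \<le> t" "t < 2 * pi" "t < a \<or> b < t"
  shows "chord_side a b (cis t) < 0"
proof -
  have neg: "sin (- x) < 0" if "0 < x" "x < pi" for x :: real using sin_gt_zero[OF that] by simp
  show ?thesis
  proof (cases "t < a")
    case True
    then have "sin ((t - a) / 2) < 0" "sin ((b - t) / 2) > 0"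
      using assms neg[of "(a - t) / 2"] sin_gt_zero[of "(b - t) / 2"] by (simp_all add: minus_divide_left)
    then show ?thesis unfolding chord_side_cis by (simp add: mult_pos_neg mult_neg_pos)
  next
    case False
    then have "sin ((t - a) / 2) > 0" "sin ((b - t) / 2) < 0"
      using assms neg[of "(t - b) / 2"] sin_gt_zero[of "(t - a) / 2"] by (simp_all add: minus_divide_left)
    then show ?thesis unfolding chord_side_cis by (simp add: mult_pos_neg)
  qed
qed

lemma chord_side_endpoint [simp]: "chord_side a b (cis a) = 0" "chord_side a b (cis b) = 0"
  by (simp_all add: chord_side_cis)

text \<open>After rotation the point has real part \<open>cos p\<close>, and the unit disc leaves
  only imaginary parts between \<open>- sin p\<close> and \<open>sin p\<close>; \<open>t\<close>
  rescales this range to the unit interval.\<close>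

lemma on_chord:
  assumes "0 \<le> a" "a < b" "b < 2 * pi" "cmod z \<le> 1" "chord_side a b z = 0"
  shows "z \<in> closed_segment (cis a) (cis b)"
proof -
  define p where "p = (b - a) / 2"
  define m where "m = (a + b) / 2"
  define y where "y = z * cis (- m)"
  define t where "t = (Im y / sin p + 1) / 2"
  have p: "0 < sin p" unfolding p_def using assms by (intro sin_gt_zero) auto
  have Re: "Re y = cos p" using assms by (simp add: chord_side_def y_def m_def p_def)
  have "cmod y \<le> 1" using assms by (simp add: y_def norm_mult)
  then have "(Re y)\<^sup>2 + (Im y)\<^sup>2 \<le> 1" by (simp add: cmod_def)
  then have "(Im y)\<^sup>2 \<le> (sin p)\<^sup>2" unfolding Re using sin_cos_squared_add[of p] by linarith
  then have "\<bar>Im y\<bar> \<le> sin p" using p by (simp add: abs_le_square_iff[symmetric])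
  then have "- 1 \<le> Im y / sin p" "Im y / sin p \<le> 1" using p by (auto simp: field_simps)
  then have t: "0 \<le> t" "t \<le> 1" unfolding t_def by auto
  have "Im y = sin p * (2 * t - 1)" using p by (simp add: t_def add_divide_distrib)
  then have "y = (1 - t) *\<^sub>R cis (- p) + t *\<^sub>R cis p"
    by (intro complex_eqI) (simp_all add: Re algebra_simps)
  moreover have "z = y * cis m" by (simp add: y_def cis_mult mult.assoc)
  moreover have "cis (- p) * cis m = cis a" "cis p * cis m = cis b"
    by (simp_all add: cis_mult p_def m_def field_simps)
  ultimately have "z = (1 - t) *\<^sub>R cis a + t *\<^sub>R cis b"
    by (simp only: distrib_right mult_scaleR_left)
  then show ?thesis using t by (auto simp: in_segment)
qed

text \<open>The affine function \<open>chord_side a b\<close> is nonnegative at \<open>cis c\<close>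
  and nonpositive at \<open>cis d\<close>, so it vanishes at a convex combination of the two, which
  stays in the unit disc. The inequalities are weak because chords sharing an endpoint meet.\<close>

lemma interleaved_chords_meet:
  assumes "0 \<le> a" "a \<le> c" "c \<le> b" "b \<le> d" "d < 2 * pi" "a < b" "c < d"
  shows "closed_segment (cis a) (cis b) \<inter> closed_segment (cis c) (cis d) \<noteq> {}"
proof -
  let ?s = "chord_side a b (cis c)" and ?t = "chord_side a b (cis d)"
  have s: "?s \<ge> 0"
    using chord_side_inside[of a c b] assms by (cases "c = a \<or> c = b") auto
  have t: "?t \<le> 0"
    using chord_side_outside[of a b d] assms by (cases "d = b") auto
  obtain u where u: "0 \<le> u" "u \<le> 1" "(1 - u) * ?s + u * ?t = 0"
  proof (cases "?s = ?t")
    case True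
    then show ?thesis using s t that[of 0] by simp
  next
    case False
    then have "?s - ?t > 0" using s t by simp
    then show ?thesis using s t that[of "?s / (?s - ?t)"] by (simp add: field_simps)
  qed
  define z where "z = (1 - u) *\<^sub>R cis c + u *\<^sub>R cis d"
  have "chord_side a b z = 0" unfolding z_def chord_side_affine using u by simp
  moreover have "cmod z \<le> 1"
  proof -
    have "cmod z \<le> cmod ((1 - u) *\<^sub>R cis c) + cmod (u *\<^sub>R cis d)"
      unfolding z_def by (rule norm_triangle_ineq)
    then show ?thesis using u by simp
  qed
  ultimately have "z \<in> closed_segment (cis a) (cis b)" using assms by (intro on_chord) auto
  moreover have "z \<in> closed_segment (cis c) (cis d)"
    unfolding z_def using u by (auto simp: in_segment)
  ultimately show ?thesis by blast
qed

lemma chords_one_side_disjoint: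
  assumes "0 < chord_side a b (cis c) \<and> 0 < chord_side a b (cis d) \<or>
    chord_side a b (cis c) < 0 \<and> chord_side a b (cis d) < 0"
  shows "closed_segment (cis a) (cis b) \<inter> closed_segment (cis c) (cis d) = {}"
proof (rule ccontr)
  assume "\<not> ?thesis"
  then obtain z where z: "z \<in> closed_segment (cis a) (cis b)" "z \<in> closed_segment (cis c) (cis d)" by blast
  obtain u where "z = (1 - u) *\<^sub>R cis a + u *\<^sub>R cis b" using z by (auto simp: in_segment)
  then have 0: "chord_side a b z = 0" by (simp add: chord_side_affine)
  obtain w where w: "0 \<le> w" "w \<le> 1" "z = (1 - w) *\<^sub>R cis c + w *\<^sub>R cis d"
    using z by (auto simp: in_segment)
  let ?s = "chord_side a b (cis c)" and ?t = "chord_side a b (cis d)"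
  have zero: "(1 - w) * ?s + w * ?t = 0" using 0 w by (simp add: chord_side_affine)
  have "(1 - w) * x + w * y > 0" if "x > 0" "y > 0" for x y :: real
    using that w by (cases "w = 0") (auto intro: add_nonneg_pos)
  from this[of ?s ?t] this[of "- ?s" "- ?t"] zero assms show False
    by (auto simp: algebra_simps)
qed

text \<open>If neither interleaving holds, both ends of the second chord lie strictly on the same
  side of the first.\<close>

lemma chords_meet_iff:
  assumes "0 \<le> a" "a < b" "b < 2 * pi" "0 \<le> c" "c < d" "d < 2 * pi"
  shows "closed_segment (cis a) (cis b) \<inter> closed_segment (cis c) (cis d) \<noteq> {} \<longleftrightarrow>
    (a \<le> c \<and> c \<le> b \<and> b \<le> d) \<or> (c \<le> a \<and> a \<le> d \<and> d \<le> b)"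
proof
  assume meet: "closed_segment (cis a) (cis b) \<inter> closed_segment (cis c) (cis d) \<noteq> {}"
  show "(a \<le> c \<and> c \<le> b \<and> b \<le> d) \<or> (c \<le> a \<and> a \<le> d \<and> d \<le> b)"
  proof (rule ccontr)
    assume neg: "\<not> ?thesis"
    then consider "a < c \<and> d < b" | "(c < a \<or> b < c) \<and> (d < a \<or> b < d)"
      using assms by linarith
    then show False
    proof cases
      case 1
      then show ?thesis
        using meet chords_one_side_disjoint[of a b c d] chord_side_inside[of a c b]
          chord_side_inside[of a d b] assms by auto
    next
      case 2
      then show ?thesis
        using meet chords_one_side_disjoint[of a b c d] chord_side_outside[of a b c]
          chord_side_outside[of a b d] assms by auto
    qed
  qed
next
  assume "(a \<le> c \<and> c \<le> b \<and> b \<le> d) \<or> (c \<le> a \<and> a \<le> d \<and> d \<le> b)"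
  then show "closed_segment (cis a) (cis b) \<inter> closed_segment (cis c) (cis d) \<noteq> {}"
    using interleaved_chords_meet[of a c b d] interleaved_chords_meet[of c a d b] assms
    by (auto simp: Int_commute)
qed

lemma cis_neq:
  assumes "0 \<le> s" "s < t" "t < 2 * pi"
  shows "cis s \<noteq> cis t"
proof
  assume eq: "cis s = cis t"
  \<comment> \<open>An auxiliary chord ending strictly before \<open>t\<close> separates the two
    points: one lies on it, the other off it.\<close>
  let ?m = "(s + t) / 2"
  have "chord_side s ?m (cis t) = 0" by (simp flip: eq)
  moreover have "chord_side s ?m (cis t) < 0"
    using assms by (intro chord_side_outside) auto
  ultimately show False by simp
qed

section \<open>Between chord diagrams and circle graphs\<close>

lemma circle_graph_of_diagram:
  assumes dia: "chord_diagram V E P"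
  shows "circle_graph V E"
proof -
  \<comment> \<open>Positions in a diagram have no fixed upper bound; this map embeds all natural
    numbers increasingly into \<open>[0, 2 * pi)\<close>.\<close>
  define \<theta> where "\<theta> p = 2 * pi * (1 - 1 / (real p + 1))" for p :: nat
  have \<theta>_less: "\<theta> p < \<theta> q" if "p < q" for p q
    using that by (simp add: \<theta>_def field_simps)
  have range: "0 \<le> \<theta> p" "\<theta> p < 2 * pi" for p by (simp_all add: \<theta>_def field_simps)
  have \<theta>_le: "\<theta> p \<le> \<theta> q \<longleftrightarrow> p \<le> q" for p q
    using \<theta>_less[of p q] \<theta>_less[of q p] by (cases p q rule: linorder_cases) auto
  define f where "f v = (cis (\<theta> (P (v, True))), cis (\<theta> (P (v, False))))" for v
  have lt: "P (v, True) < P (v, False)" if "v \<in> V" for v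
    using dia that by (auto simp: chord_diagram_def chord_ends_def)
  have "fst (f v) \<noteq> snd (f v)" if "v \<in> V" for v
    unfolding f_def using cis_neq[OF range(1) \<theta>_less[OF lt[OF that]] range(2)] by simp
  moreover have "E u v \<longleftrightarrow>
      closed_segment (fst (f u)) (snd (f u)) \<inter> closed_segment (fst (f v)) (snd (f v)) \<noteq> {}"
    if uv: "u \<in> V" "v \<in> V" "u \<noteq> v" for u v
  proof -
    have ne: "P (u, b) \<noteq> P (v, b')" for b b'
      using dia uv by (auto simp: chord_diagram_def chord_ends_def dest: inj_onD)
    have "E u v \<longleftrightarrow> overlap P u v \<or> overlap P v u"
      using dia uv by (auto simp: chord_diagram_def)
    also have "\<dots> \<longleftrightarrow> closed_segment (fst (f u)) (snd (f u)) \<inter> closed_segment (fst (f v)) (snd (f v)) \<noteq> {}"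
      unfolding f_def fst_conv snd_conv overlap_def
        chords_meet_iff[OF range(1) \<theta>_less[OF lt[OF uv(1)]] range(2) range(1) \<theta>_less[OF lt[OF uv(2)]] range(2)]
        \<theta>_le
      using ne[of True True] ne[of True False] ne[of False True] ne[of False False] by linarith
    finally show ?thesis .
  qed
  ultimately show ?thesis
    unfolding circle_graph_def by (intro exI[of _ f]) (auto simp: f_def)
qed

lemma rank_exists:
  assumes fin: "finite D" and irr: "\<And>x. \<not> R x x" and trans: "\<And>x y z. R x y \<Longrightarrow> R y z \<Longrightarrow> R x z"
    and total: "\<And>x y. x \<in> D \<Longrightarrow> y \<in> D \<Longrightarrow> x \<noteq> y \<Longrightarrow> R x y \<or> R y x"
  shows "\<exists>P. bij_betw P D {..<card D} \<and> (\<forall>x\<in>D. \<forall>y\<in>D. P x < P y \<longleftrightarrow> R x y)"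
proof -
  define P where "P y = card {x\<in>D. R x y}" for y
  have mono: "P x < P y" if "x \<in> D" "R x y" for x y
  proof -
    have "x \<in> {z\<in>D. R z y}" "x \<notin> {z\<in>D. R z x}" using that irr by auto
    moreover have "{z\<in>D. R z x} \<subseteq> {z\<in>D. R z y}" using that trans by blast
    ultimately have "{z\<in>D. R z x} \<subset> {z\<in>D. R z y}" by blast
    then show ?thesis unfolding P_def using fin by (intro psubset_card_mono) auto
  qed
  have iff: "P x < P y \<longleftrightarrow> R x y" if "x \<in> D" "y \<in> D" for x y
    using mono[of x y] mono[of y x] total[of x y] that by (cases "x = y") auto
  have inj: "inj_on P D"
  proof (rule inj_onI)
    fix x y assume "x \<in> D" "y \<in> D" "P x = P y"
    then show "x = y" using iff[of x y] iff[of y x] total[of x y] by auto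
  qed
  have "P x < card D" if "x \<in> D" for x
  proof -
    have "x \<notin> {z\<in>D. R z x}" using irr by simp
    then have "{z\<in>D. R z x} \<subset> D" using that by blast
    then show ?thesis unfolding P_def using fin by (intro psubset_card_mono)
  qed
  then have "P ` D \<subseteq> {..<card D}" by blast
  then have "P ` D = {..<card D}"
    using card_image[OF inj] by (intro card_subset_eq) auto
  then have "bij_betw P D {..<card D}" using inj by (simp add: bij_betw_def)
  then show ?thesis using iff by blast
qed

text \<open>The cut is at angle 0, so the smaller argument is the left endpoint. Positions without
  gaps are what later makes the honest states a path of unit steps.\<close>

lemma diagram_of_circle_graph:
  assumes fin: "finite V" and circ: "circle_graph V E"
  shows "\<exists>P. chord_diagram V E P \<and> bij_betw P (V \<times> UNIV) {..<2 * card V}"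
proof -
  from circ obtain f where f: "\<And>v. v \<in> V \<Longrightarrow> cmod (fst (f v)) = 1 \<and> cmod (snd (f v)) = 1 \<and> fst (f v) \<noteq> snd (f v)"
    and E: "\<And>u v. u \<in> V \<Longrightarrow> v \<in> V \<Longrightarrow> u \<noteq> v \<Longrightarrow> E u v \<longleftrightarrow>
      closed_segment (fst (f u)) (snd (f u)) \<inter> closed_segment (fst (f v)) (snd (f v)) \<noteq> {}"
    unfolding circle_graph_def by blast
  define s where "s v = min (Arg2pi (fst (f v))) (Arg2pi (snd (f v)))" for v
  define t where "t v = max (Arg2pi (fst (f v))) (Arg2pi (snd (f v)))" for v
  have cis: "cis (Arg2pi z) = z" if "cmod z = 1" for z
    using complex_norm_eq_1_exp[of z] that by (simp add: cis_conv_exp)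
  have st: "0 \<le> s v" "s v < t v" "t v < 2 * pi" if "v \<in> V" for v
    using f[OF that] cis[of "fst (f v)"] cis[of "snd (f v)"] Arg2pi[of "fst (f v)"] Arg2pi[of "snd (f v)"]
    unfolding s_def t_def by (auto simp: min_def max_def less_le)
  have seg: "closed_segment (fst (f v)) (snd (f v)) = closed_segment (cis (s v)) (cis (t v))" if "v \<in> V" for v
    using f[OF that] by (auto simp: s_def t_def min_def max_def cis closed_segment_commute)
  have E': "E u v \<longleftrightarrow> (s u \<le> s v \<and> s v \<le> t u \<and> t u \<le> t v) \<or> (s v \<le> s u \<and> s u \<le> t v \<and> t v \<le> t u)"
    if "u \<in> V" "v \<in> V" "u \<noteq> v" for u v
    unfolding E[OF that] seg[OF that(1)] seg[OF that(2)]
    using st[OF that(1)] st[OF that(2)] by (intro chords_meet_iff) auto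

  \<comment> \<open>Chords with a common endpoint meet, so ties must be broken such that they overlap: at a common
     point left endpoints precede right endpoints, and equal kinds are ordered by the other end.\<close>
  define k1 where "k1 e = (if snd e then s (fst e) else t (fst e))" for e :: "nat \<times> bool"
  define k2 :: "nat \<times> bool \<Rightarrow> nat" where "k2 e = (if snd e then 0 else 1)" for e
  define k3 where "k3 e = (if snd e then t (fst e) else s (fst e))" for e :: "nat \<times> bool"
  define R where "R e e' \<longleftrightarrow> k1 e < k1 e' \<or> k1 e = k1 e' \<and> (k2 e < k2 e' \<or> k2 e = k2 e' \<and>
    (k3 e < k3 e' \<or> k3 e = k3 e' \<and> fst e < fst e'))" for e e'
  have "\<exists>P. bij_betw P (V \<times> UNIV) {..<card (V \<times> (UNIV :: bool set))} \<and>
      (\<forall>x\<in>V \<times> UNIV. \<forall>y\<in>V \<times> UNIV. P x < P y \<longleftrightarrow> R x y)"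
  proof (rule rank_exists)
    show "R x z" if "R x y" "R y z" for x y z
      using that unfolding R_def by (elim disjE conjE) auto
    show "R x y \<or> R y x" if "x \<noteq> y" for x y
      using that unfolding R_def k2_def by (cases x; cases y) (auto split: if_splits)
  qed (use fin in \<open>auto simp: R_def\<close>)
  then obtain P where bij: "bij_betw P (V \<times> UNIV) {..<2 * card V}" and
    P: "\<And>u b v b'. u \<in> V \<Longrightarrow> v \<in> V \<Longrightarrow> P (u, b) < P (v, b') \<longleftrightarrow> R (u, b) (v, b')"
    by (auto simp: card_cartesian_product mult.commute)
  have "E u v \<longleftrightarrow> overlap P u v \<or> overlap P v u" if "u \<in> V" "v \<in> V" "u \<noteq> v" for u v
  proof -
    \<comment> \<open>The last clause concerns coincident chords: the smaller identifier comes first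
      at both ends, so exactly one of the two directions is an overlap.\<close>
    have ov: "overlap P u v \<longleftrightarrow> s u \<le> s v \<and> s v \<le> t u \<and> t u \<le> t v \<and> (s u = s v \<and> t u = t v \<longrightarrow> u < v)"
      if "u \<in> V" "v \<in> V" for u v
      using that st[OF that(1)] st[OF that(2)] unfolding overlap_def
      by (auto simp: P R_def k1_def k2_def k3_def)
    show ?thesis
      unfolding E'[OF that] ov[OF that(1,2)] ov[OF that(2,1)] using that(3)
      by (cases u v rule: linorder_cases) auto
  qed
  moreover have "P (v, True) < P (v, False)" if "v \<in> V" for v
    using st[OF that] that by (simp add: P R_def k1_def)
  ultimately have "chord_diagram V E P"
    using bij by (auto simp: chord_diagram_def chord_ends_def bij_betw_def)
  then show ?thesis using bij by blast
qed

subsection \<open>The protocol\<close>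

text \<open>A lattice state \<open>(i, j)\<close> counts the left and right endpoints before a given endpoint. The field
  \<open>total\<close>, the claimed number of nodes, is read at the tree root only.\<close>

datatype cert = Cert (tree_root: nat) (parent: nat) (total: nat) (left_state: "nat \<times> nat") (right_state: "nat \<times> nat")

definition state :: "(nat \<Rightarrow> cert) \<Rightarrow> nat \<times> bool \<Rightarrow> nat \<times> nat" where
  "state a e = (if snd e then left_state (a (fst e)) else right_state (a (fst e)))"

text \<open>With correct counts the level of a state is the number of all endpoints before it, so
  the order of the endpoints needs no certificate of its own.\<close>

definition position :: "(nat \<Rightarrow> cert) \<Rightarrow> nat \<times> bool \<Rightarrow> nat" where
  "position a e = lev (state a e)"

text \<open>Each endpoint is an edge from its state to the next one. The root adds a virtual edge
  from the end of the path back to the origin, so that an honest path becomes a circulation of total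
  flow zero.\<close>

definition node_flow :: "(nat \<times> nat \<Rightarrow> int) \<Rightarrow> (nat \<Rightarrow> cert) \<Rightarrow> nat \<Rightarrow> int" where
  "node_flow w a v = (\<Sum>b\<in>UNIV. w (step b (state a (v, b))) - w (state a (v, b))) +
     (if v = tree_root (a v) then w (0, 0) - w (total (a v), total (a v)) else 0)"

text \<open>The last equation compares the difference of the numbers of neighbours overlapping from the left and
  to the right with the value that \<open>overlap_balance\<close> derives from the lattice states.\<close>

definition diagram_check :: "nat \<Rightarrow> nat set \<Rightarrow> (nat \<Rightarrow> cert) \<Rightarrow> bool" where
  "diagram_check v S a \<longleftrightarrow>
     position a (v, True) < position a (v, False) \<and>
     (v \<noteq> tree_root (a v) \<longrightarrow> parent (a v) \<in> S) \<and>
     (\<forall>u\<in>S. tree_root (a u) = tree_root (a v) \<and> (overlap (position a) u v \<or> overlap (position a) v u)) \<and>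
     int (card {u\<in>S. position a (u, True) < position a (v, True)}) -
     int (card {u\<in>S. position a (v, True) < position a (u, True)}) =
     (int (snd (right_state (a v))) - int (snd (left_state (a v)))) -
     (int (fst (right_state (a v))) - int (fst (left_state (a v))) - 1)"

definition sum_check :: "(nat \<times> nat \<Rightarrow> int) \<Rightarrow> nat \<Rightarrow> nat set \<Rightarrow> (nat \<Rightarrow> cert) \<Rightarrow> (nat \<Rightarrow> int) \<Rightarrow> bool" where
  "sum_check w v S a s \<longleftrightarrow>
     s v = node_flow w a v + (\<Sum>u | u \<in> S \<and> u \<noteq> tree_root (a u) \<and> parent (a u) = v. s u) \<and>
     (v = tree_root (a v) \<longrightarrow> s v = 0)"

definition certs :: "nat \<Rightarrow> nat \<Rightarrow> cert set" where
  "certs c N = (\<lambda>(r, p, n, q, q'). Cert r p n q q') `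
     ({..N ^ c} \<times> {..N ^ c} \<times> {..N} \<times> ({..N} \<times> {..N}) \<times> ({..N} \<times> {..N}))"

text \<open>A node contributes at most three differences of weights from \<open>{0..3}\<close>, hence the factor 9.\<close>

definition agg_values :: "nat \<Rightarrow> int set" where
  "agg_values N = {- (9 * int N)..9 * int N}"

text \<open>Claimed counts reach up to \<open>N\<close>, and a step from such a state may reach
  \<open>N + 1\<close>; this target needs a weight as well.\<close>

definition states :: "nat \<Rightarrow> (nat \<times> nat) set" where
  "states N = {..N + 1} \<times> {..N + 1}"

lemma finite_states [simp]: "finite (states N)"
  by (simp add: states_def)

section \<open>Sizes of certificates and locality of the checks\<close>

lemma certs_iff:
  "x \<in> certs c N \<longleftrightarrow> tree_root x \<le> N ^ c \<and> parent x \<le> N ^ c \<and> total x \<le> N \<and>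
     left_state x \<in> {..N} \<times> {..N} \<and> right_state x \<in> {..N} \<times> {..N}"
  by (cases x) (auto simp: certs_def image_iff)

lemma certs_bound:
  assumes "1 \<le> c"
  shows "finite (certs c N) \<and> card (certs c N) \<le> (N + 2) ^ (2 * c + 6)"
proof
  let ?T = "{..N ^ c} \<times> {..N ^ c} \<times> {..N} \<times> ({..N} \<times> {..N}) \<times> ({..N} \<times> {..N})"
  show "finite (certs c N)" by (simp add: certs_def)
  have "card (certs c N) \<le> card ?T" unfolding certs_def by (rule card_image_le) simp
  also have "\<dots> = Suc (N ^ c) * (Suc (N ^ c) * (Suc N * (Suc N * Suc N * (Suc N * Suc N))))"
    by (simp add: card_cartesian_product)
  also have "\<dots> \<le> (N + 2) ^ c * ((N + 2) ^ c * ((N + 2) * ((N + 2) * (N + 2) * ((N + 2) * (N + 2)))))"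
    by (intro mult_le_mono Suc_power_le[OF assms]) simp_all
  also have "\<dots> = (N + 2) ^ (2 * c + 5)"
  proof -
    have "x ^ c * (x ^ c * (x * (x * x * (x * x)))) = x ^ (2 * c + 5)" for x :: nat
      by (simp add: power_add mult_2 eval_nat_numeral mult_ac)
    then show ?thesis .
  qed
  \<comment> \<open>The exponent is raised by one to share it with the second certificates.\<close>
  also have "\<dots> \<le> (N + 2) ^ (2 * c + 6)" by (intro power_increasing) auto
  finally show "card (certs c N) \<le> (N + 2) ^ (2 * c + 6)" .
qed

lemma agg_values_bound: "finite (agg_values N) \<and> card (agg_values N) \<le> (N + 2) ^ (2 * c + 6)"
proof
  \<comment> \<open>There are \<open>18 * N + 1\<close> values; absorbing the constant as
    \<open>2 ^ 5 \<le> (N + 2) ^ 5\<close> is the origin of the 6.\<close>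
  have "card (agg_values N) \<le> 2 ^ 5 * (N + 2)" by (simp add: agg_values_def)
  also have "\<dots> \<le> (N + 2) ^ 5 * (N + 2)" by (intro mult_le_mono1 power_mono) auto
  also have "\<dots> = (N + 2) ^ 6"
    using power_Suc2[of "N + 2" 5] by simp
  also have "\<dots> \<le> (N + 2) ^ (2 * c + 6)" by (intro power_increasing) auto
  finally show "card (agg_values N) \<le> (N + 2) ^ (2 * c + 6)" .
qed (simp add: agg_values_def)

lemma position_cong: "a u = a' u \<Longrightarrow> position a (u, b) = position a' (u, b)"
  by (simp add: position_def state_def)

lemma diagram_check_cong:
  assumes "\<forall>u\<in>insert v S. a u = a' u" "diagram_check v S a"
  shows "diagram_check v S a'"
proof -
  have u: "a u = a' u" if "u \<in> S" for u using assms(1) that by auto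
  have pos: "position a (u, b) = position a' (u, b)" if "u \<in> insert v S" for u b
    using position_cong assms(1) that by blast
  have "{u\<in>S. position a' (u, True) < position a' (v, True)} = {u\<in>S. position a (u, True) < position a (v, True)}"
    "{u\<in>S. position a' (v, True) < position a' (u, True)} = {u\<in>S. position a (v, True) < position a (u, True)}"
    using pos by auto
  moreover have "overlap (position a') u v = overlap (position a) u v"
    "overlap (position a') v u = overlap (position a) v u" if "u \<in> S" for u
    using pos that by (simp_all add: overlap_def)
  moreover have "a v = a' v" using assms(1) by simp
  ultimately show ?thesis
    using assms(2) u pos[of v] unfolding diagram_check_def by auto
qed

lemma sum_check_cong:
  assumes "\<forall>u\<in>insert v S. a u = a' u \<and> s u = s' u" "sum_check w v S a s"
  shows "sum_check w v S a' s'"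
proof -
  have "(\<Sum>u | u \<in> S \<and> u \<noteq> tree_root (a u) \<and> parent (a u) = v. s u) =
    (\<Sum>u | u \<in> S \<and> u \<noteq> tree_root (a' u) \<and> parent (a' u) = v. s' u)"
    using assms(1) by (intro sum.cong) auto
  moreover have "a v = a' v" "s v = s' v" using assms(1) by auto
  moreover from this have "state a (v, b) = state a' (v, b)" for b by (simp add: state_def)
  with \<open>a v = a' v\<close> have "node_flow w a v = node_flow w a' v" by (simp add: node_flow_def)
  ultimately show ?thesis using assms(2) unfolding sum_check_def by metis
qed

lemma card_weights: "card (states N \<rightarrow>\<^sub>E {0..3 :: int}) = 2 ^ (2 * card (states N))"
  by (simp add: card_PiE power_mult)

section \<open>Soundness and completeness of the protocol\<close>

lemma sum_node_flow:
  assumes fin: "finite V" and root: "\<And>v. v \<in> V \<Longrightarrow> tree_root (a v) = \<rho>"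
  shows "(\<Sum>v\<in>V. node_flow w a v) =
    (\<Sum>e\<in>V \<times> UNIV. w (step (snd e) (state a e)) - w (state a e)) +
    (if \<rho> \<in> V then w (0, 0) - w (total (a \<rho>), total (a \<rho>)) else 0)"
proof -
  have "(\<Sum>v\<in>V. \<Sum>b\<in>UNIV. w (step b (state a (v, b))) - w (state a (v, b))) =
      (\<Sum>e\<in>V \<times> UNIV. w (step (snd e) (state a e)) - w (state a e))"
    by (subst sum.cartesian_product) (simp add: case_prod_unfold)
  moreover have "(\<Sum>v\<in>V. if v = tree_root (a v) then w (0, 0) - w (total (a v), total (a v)) else 0) =
      (\<Sum>v\<in>V. if v = \<rho> then w (0, 0) - w (total (a \<rho>), total (a \<rho>)) else 0)"
    using root by (intro sum.cong) auto
  ultimately show ?thesis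
    using fin by (simp add: node_flow_def sum.distrib)
qed

text \<open>The first certificates alone determine the linear form \<open>g\<close>, and acceptance
  forces it to vanish at the drawn weights. If \<open>g\<close> were zero on all states, the claimed
  states would describe a genuine chord diagram of the graph.\<close>

lemma soundness:
  assumes val: "valid_config c V E" and not_circle: "\<not> circle_graph V E"
    and a: "\<And>v. v \<in> V \<Longrightarrow> a v \<in> certs c N"
  defines "Acc \<equiv> {w \<in> states N \<rightarrow>\<^sub>E {0..3}. \<exists>s. (\<forall>v\<in>V. s v \<in> agg_values N) \<and>
    (\<forall>v\<in>V. diagram_check v {u\<in>V. E v u} a \<and> sum_check w v {u\<in>V. E v u} a s)}"
  shows "3 * card Acc \<le> card (states N \<rightarrow>\<^sub>E {0..3 :: int})"
proof (cases "Acc = {}")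
  case False
  have fin: "finite V" and ne: "V \<noteq> {}" and EV: "\<And>u v. E u v \<Longrightarrow> u \<in> V \<and> v \<in> V"
    and sym: "\<And>u v. E u v \<Longrightarrow> E v u"
    and conn: "\<And>u v. u \<in> V \<Longrightarrow> v \<in> V \<Longrightarrow> E\<^sup>*\<^sup>* u v"
    using val by (auto simp: valid_config_def)
  \<comment> \<open>\<open>diagram_check\<close> does not involve the weights, so a single accepting
    outcome establishes it for all nodes.\<close>
  have chk: "diagram_check v {u\<in>V. E v u} a" if "v \<in> V" for v
    using False that by (auto simp: Acc_def)
  obtain v0 where v0: "v0 \<in> V" using ne by blast
  define \<rho> where "\<rho> = tree_root (a v0)"
  have root: "tree_root (a v) = \<rho>" if "v \<in> V" for v
    using conn[OF v0 that]
  proof induction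
    case (step y z)
    then show ?case using chk[of y] EV[of y z] by (auto simp: diagram_check_def)
  qed (simp add: \<rho>_def)
  let ?D = "V \<times> (UNIV :: bool set)"
  let ?src = "\<lambda>q. {e\<in>?D. state a e = q}" and ?dst = "\<lambda>q. {e\<in>?D. step (snd e) (state a e) = q}"
  define t where "t = (total (a \<rho>), total (a \<rho>))"
  \<comment> \<open>Net inflow at \<open>q\<close>, including the virtual edge from \<open>t\<close>
    to the origin; that edge is absent if the claimed root is not a node of the graph.\<close>
  define g where "g q = int (card (?dst q)) - int (card (?src q)) +
    (if \<rho> \<in> V then of_bool (q = (0, 0)) - of_bool (q = t) else 0)" for q
  have finD: "finite ?D" using fin by simp
  have state_in: "state a e \<in> {..N} \<times> {..N}" if "e \<in> ?D" for e
    using a[of "fst e"] that by (auto simp: certs_iff state_def)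
  have src_in: "state a ` ?D \<subseteq> states N"
  proof (rule image_subsetI)
    show "state a e \<in> states N" if "e \<in> ?D" for e
      using state_in[OF that] by (auto simp: states_def)
  qed
  have dst_in: "(\<lambda>e. step (snd e) (state a e)) ` ?D \<subseteq> states N"
  proof (rule image_subsetI)
    show "step (snd e) (state a e) \<in> states N" if "e \<in> ?D" for e
      using state_in[OF that] by (auto simp: states_def step_def)
  qed
  have flow_sum: "(\<Sum>v\<in>V. node_flow w a v) = (\<Sum>q\<in>states N. g q * w q)" for w
  proof -
    have pick: "(\<Sum>q\<in>states N. of_bool (q = z) * w q) = w z" if "z \<in> states N" for z
      using that by (simp add: of_bool_def if_distrib[of "\<lambda>x. x * _"] cong: if_cong)
    have "(\<Sum>q\<in>states N. g q * w q) =
        (\<Sum>q\<in>states N. int (card (?dst q)) * w q) - (\<Sum>q\<in>states N. int (card (?src q)) * w q) +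
        (if \<rho> \<in> V then (\<Sum>q\<in>states N. of_bool (q = (0, 0)) * w q) -
          (\<Sum>q\<in>states N. of_bool (q = t) * w q) else 0)"
      unfolding g_def by (simp add: algebra_simps sum.distrib sum_subtractf)
    also have "(\<Sum>q\<in>states N. int (card (?dst q)) * w q) = (\<Sum>e\<in>?D. w (step (snd e) (state a e)))"
      by (rule sum_by_fibres[OF finD finite_states dst_in, symmetric])
    also have "(\<Sum>q\<in>states N. int (card (?src q)) * w q) = (\<Sum>e\<in>?D. w (state a e))"
      by (rule sum_by_fibres[OF finD finite_states src_in, symmetric])
    also have "(if \<rho> \<in> V then (\<Sum>q\<in>states N. of_bool (q = (0, 0)) * w q) -
          (\<Sum>q\<in>states N. of_bool (q = t) * w q) else 0) = (if \<rho> \<in> V then w (0, 0) - w t else 0)"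
    proof (cases "\<rho> \<in> V")
      case True
      then have "t \<in> states N" using a[of \<rho>] by (auto simp: certs_iff t_def states_def)
      moreover have "(0, 0) \<in> states N" by (simp add: states_def)
      ultimately show ?thesis by (simp only: pick)
    qed simp
    finally show ?thesis
      using sum_node_flow[of V a \<rho> w] fin root by (simp add: sum_subtractf t_def)
  qed
  have zero: "(\<Sum>q\<in>states N. g q * w q) = 0" if w: "w \<in> Acc" for w
  proof -
    from w obtain s where s: "\<And>v. v \<in> V \<Longrightarrow> sum_check w v {u\<in>V. E v u} a s" by (auto simp: Acc_def)
    have "(\<Sum>v\<in>V. node_flow w a v) = 0"
    proof (rule parent_sums_root[where s = s and \<rho> = \<rho> and par = "\<lambda>u. parent (a u)"])
      show "parent (a u) \<in> V" if "u \<in> V" "u \<noteq> \<rho>" for u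
        using chk[OF that(1)] root[OF that(1)] that(2) by (auto simp: diagram_check_def)
      show "s \<rho> = 0" if "\<rho> \<in> V" using s[OF that] root[OF that] by (simp add: sum_check_def)
      show "s v = node_flow w a v + (\<Sum>u | u \<in> V \<and> u \<noteq> \<rho> \<and> parent (a u) = v. s u)" if v: "v \<in> V" for v
      proof -
        \<comment> \<open>Every node other than the root checks that its parent is a neighbour, so a
          sum over neighbours misses no child.\<close>
        have "E v u" if "u \<in> V" "u \<noteq> \<rho>" "parent (a u) = v" for u
          using chk[OF that(1)] root[OF that(1)] that sym by (auto simp: diagram_check_def)
        then have "{u. u \<in> V \<and> u \<noteq> \<rho> \<and> parent (a u) = v} =
            {u. u \<in> {u\<in>V. E v u} \<and> u \<noteq> tree_root (a u) \<and> parent (a u) = v}"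
          using root by auto
        then show ?thesis using s[OF v] by (simp add: sum_check_def)
      qed
    qed (rule fin)
    then show ?thesis by (simp add: flow_sum)
  qed
  have "\<exists>q\<in>states N. g q \<noteq> 0"
  proof (rule ccontr)
    assume "\<not> ?thesis"
    then have g0: "g q = 0" if "q \<in> states N" for q using that by blast
    \<comment> \<open>The sink at \<open>t\<close> only lowers the number of outgoing edges, so the
      inequality holds for a false \<open>total\<close> and also for a claimed root outside
      \<open>V\<close>.\<close>
    have flow: "card (?src q) \<le> card (?dst q) + of_bool (q = (0, 0))" for q
    proof (cases "q \<in> states N")
      case True
      show ?thesis using g0[OF True] by (auto simp: g_def of_bool_def split: if_splits)
    next
      case False
      then have "?src q = {}" using src_in by blast
      then have "card (?src q) = 0" by (simp only: card.empty)
      then show ?thesis by (simp only: le0)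
    qed
    let ?P = "position a"
    have inj: "inj_on ?P ?D"
      using lattice_flow(1)[OF finD flow] by (simp add: comp_def position_def[abs_def])
    have card_half: "card {e\<in>?D. snd e = b \<and> ?P e < p} = card {u\<in>V. ?P (u, b) < p}" for b p
    proof -
      have "{e\<in>?D. snd e = b \<and> ?P e < p} = (\<lambda>u. (u, b)) ` {u\<in>V. ?P (u, b) < p}" by auto
      then show ?thesis by (simp add: card_image inj_on_def)
    qed
    \<comment> \<open>The order is itself read off the claimed states; the path property makes them
      the true counts with respect to that order.\<close>
    have st: "state a (v, b) = (card {u\<in>V. ?P (u, True) < ?P (v, b)}, card {u\<in>V. ?P (u, False) < ?P (v, b)})"
      if "v \<in> V" for v b
      using lattice_flow(2)[OF finD flow, of "(v, b)"] that card_half[of True] card_half[of False]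
      by (simp add: position_def)
    have ends: "chord_ends V ?P" unfolding chord_ends_def using inj chk by (auto simp: diagram_check_def)
    have cross: "overlap ?P u v \<or> overlap ?P v u" if "E u v" for u v
      using chk[of u] EV[OF that] that by (auto simp: diagram_check_def)
    have bal: "int (card {u\<in>V. E v u \<and> ?P (u, True) < ?P (v, True)}) -
        int (card {u\<in>V. E v u \<and> ?P (v, True) < ?P (u, True)}) =
        int (card {u\<in>V. overlap ?P u v}) - int (card {u\<in>V. overlap ?P v u})" if v: "v \<in> V" for v
      using chk[OF v] st[OF v, of True] st[OF v, of False] overlap_balance[OF fin ends v]
      by (simp add: diagram_check_def state_def)
    have "E u v" if "u \<in> V" "v \<in> V" "overlap ?P u v" for u v
      by (rule all_overlaps_adjacent[OF fin EV sym cross bal]) (use that in auto)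
    then have "chord_diagram V E ?P"
      using ends cross sym by (auto simp: chord_diagram_def)
    then show False using circle_graph_of_diagram not_circle by blast
  qed
  then obtain q where q: "q \<in> states N" "g q \<noteq> 0" by blast
  have "card Acc \<le> card {w \<in> states N \<rightarrow>\<^sub>E {0..3}. (\<Sum>q\<in>states N. g q * w q) = 0}"
  proof (rule card_mono)
    show "finite {w \<in> states N \<rightarrow>\<^sub>E {0..3 :: int}. (\<Sum>q\<in>states N. g q * w q) = 0}"
      by (rule finite_subset[OF Collect_restrict]) (intro finite_PiE; simp)
    show "Acc \<subseteq> {w \<in> states N \<rightarrow>\<^sub>E {0..3}. (\<Sum>q\<in>states N. g q * w q) = 0}"
      using zero unfolding Acc_def by blast
  qed
  then show ?thesis using zero_sum_count[where g = g, OF finite_states q] by simp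
qed simp

lemma completeness:
  assumes val: "valid_config c V E" and N: "card V \<le> N" and circ: "circle_graph V E"
  shows "\<exists>a. (\<forall>v\<in>V. a v \<in> certs c N) \<and>
    (\<forall>w \<in> states N \<rightarrow>\<^sub>E {0..3}. \<exists>s. (\<forall>v\<in>V. s v \<in> agg_values N) \<and>
      (\<forall>v\<in>V. diagram_check v {u\<in>V. E v u} a \<and> sum_check w v {u\<in>V. E v u} a s))"
proof -
  have fin: "finite V" and ne: "V \<noteq> {}" and EV: "\<And>u v. E u v \<Longrightarrow> u \<in> V \<and> v \<in> V"
    and sym: "\<And>u v. E u v \<Longrightarrow> E v u" and irr: "\<And>v. \<not> E v v"
    and conn: "\<And>u v. u \<in> V \<Longrightarrow> v \<in> V \<Longrightarrow> E\<^sup>*\<^sup>* u v"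
    using val by (auto simp: valid_config_def)
  have id_le: "v \<le> N ^ c" if "v \<in> V" for v
  proof -
    have "v \<le> card V ^ c" using val that by (auto simp: valid_config_def)
    also have "\<dots> \<le> N ^ c" using N by (intro power_mono) auto
    finally show ?thesis .
  qed
  let ?n = "card V" and ?D = "V \<times> (UNIV :: bool set)"
  obtain P where dia: "chord_diagram V E P" and bij: "bij_betw P ?D {..<2 * ?n}"
    using diagram_of_circle_graph[OF fin circ] by blast
  have inj: "inj_on P ?D" using bij by (rule bij_betw_imp_inj_on)
  have ends: "chord_ends V P" using dia by (simp add: chord_diagram_def)
  obtain \<rho> where \<rho>: "\<rho> \<in> V" using ne by blast
  have "grown E \<rho> V" using grown_connected[of V \<rho> E] fin \<rho> EV conn by blast
  from aggregates_exist[OF this] obtain par where par: "\<And>f. \<exists>s. aggregates E \<rho> V par f s" by blast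
  have parE: "par u \<in> V \<and> E (par u) u" if "u \<in> V" "u \<noteq> \<rho>" for u
    using par[of "\<lambda>_. 0"] that by (auto simp: aggregates_def)

  define \<sigma> where "\<sigma> p = (card {u\<in>V. P (u, True) < p}, card {u\<in>V. P (u, False) < p})" for p
  \<comment> \<open>Merlin knows \<open>?n\<close>, the nodes do not. The root's pointer gets the
    default \<open>\<rho>\<close>, which respects the bound on identifiers in
    \<open>certs\<close>.\<close>
  define a where "a v = Cert \<rho> (if v = \<rho> then \<rho> else par v) ?n (\<sigma> (P (v, True))) (\<sigma> (P (v, False)))" for v
  have a_sel [simp]: "tree_root (a v) = \<rho>" "parent (a v) = (if v = \<rho> then \<rho> else par v)" "total (a v) = ?n"
    "left_state (a v) = \<sigma> (P (v, True))" "right_state (a v) = \<sigma> (P (v, False))" for v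
    by (simp_all add: a_def)
  have state_a: "state a e = \<sigma> (P e)" for e
    by (cases e) (simp add: state_def)
  have card_le: "card {u\<in>V. Q u} \<le> N" for Q
    using card_mono[OF fin, of "{u\<in>V. Q u}"] N by fastforce
  have \<sigma>_in: "\<sigma> p \<in> {..N} \<times> {..N}" for p by (simp add: \<sigma>_def card_le)
  have certs: "a v \<in> certs c N" if "v \<in> V" for v
    using id_le \<rho> that parE[OF that] N \<sigma>_in by (auto simp: certs_iff)

  \<comment> \<open>Positions fill \<open>{..<2 * ?n}\<close> without gaps, so exactly
    \<open>p\<close> endpoints precede position \<open>p\<close>, and the nodes recover
    \<open>P\<close> from the levels.\<close>
  have lev_\<sigma>: "lev (\<sigma> p) = p" if "p \<le> 2 * ?n" for p
  proof -
    have "{e\<in>?D. P e < p} = (\<lambda>u. (u, True)) ` {u\<in>V. P (u, True) < p} \<union> (\<lambda>u. (u, False)) ` {u\<in>V. P (u, False) < p}"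
      (is "_ = ?A \<union> ?B")
    proof (intro equalityI subsetI)
      fix e assume "e \<in> {e\<in>?D. P e < p}"
      then show "e \<in> ?A \<union> ?B" by (cases e; cases "snd e") auto
    qed auto
    then have "card {e\<in>?D. P e < p} = card ?A + card ?B"
      using fin by (simp only:) (intro card_Un_disjoint; auto)
    also have "\<dots> = lev (\<sigma> p)"
      by (simp add: lev_def \<sigma>_def card_image inj_on_def)
    finally have "lev (\<sigma> p) = card {e\<in>?D. P e < p}" by simp
    also have "\<dots> = card (P ` {e\<in>?D. P e < p})"
      using inj by (intro card_image[symmetric]) (auto intro: inj_on_subset)
    also have "P ` {e\<in>?D. P e < p} = {..<p}"
    proof (intro equalityI subsetI)
      fix x assume "x \<in> {..<p}"
      then have "x \<in> P ` ?D" using bij that by (auto simp: bij_betw_def)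
      then show "x \<in> P ` {e\<in>?D. P e < p}" using \<open>x \<in> {..<p}\<close> by auto
    qed auto
    finally show ?thesis by simp
  qed
  have pos: "position a e = P e" if "e \<in> ?D" for e
  proof -
    have "P e < 2 * ?n" using bij_betwE[OF bij] that by blast
    then show ?thesis by (simp add: position_def state_a lev_\<sigma>)
  qed
  have pos': "position a (v, b) = P (v, b)" if "v \<in> V" for v b using pos that by simp

  have diagram: "diagram_check v {u\<in>V. E v u} a" if v: "v \<in> V" for v
  proof -
    have adj: "E v u \<longleftrightarrow> overlap P u v \<or> overlap P v u" if "u \<in> V" for u
    proof (cases "u = v")
      case True
      then show ?thesis using irr by (auto simp: overlap_def)
    next
      case False
      then show ?thesis using dia v that by (auto simp: chord_diagram_def)
    qed
    have "{u \<in> {u\<in>V. E v u}. position a (u, True) < position a (v, True)} = {u\<in>V. overlap P u v}"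
      "{u \<in> {u\<in>V. E v u}. position a (v, True) < position a (u, True)} = {u\<in>V. overlap P v u}"
      using adj v by (auto simp: pos' overlap_def)
    moreover have "overlap (position a) u x = overlap P u x" if "u \<in> V" "x \<in> V" for u x
      using that by (simp add: overlap_def pos')
    moreover have "P (v, True) < P (v, False)" using ends v by (simp add: chord_ends_def)
    ultimately show ?thesis
      unfolding diagram_check_def
      using overlap_balance[OF fin ends v] adj v parE[OF v] sym by (auto simp: pos' \<sigma>_def)
  qed

  have step_\<sigma>: "step (snd e) (\<sigma> (P e)) = \<sigma> (Suc (P e))" if e: "e \<in> ?D" for e
  proof -
    have "{u\<in>V. P (u, b) < Suc (P e)} = {u\<in>V. P (u, b) < P e} \<union> (if snd e = b then {fst e} else {})" for b
    proof -
      have "P (u, b) = P e \<longleftrightarrow> u = fst e \<and> b = snd e" if "u \<in> V" for u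
        using inj_on_eq_iff[OF inj, of "(u, b)" e] e that by (cases e) auto
      then show ?thesis using e by (auto simp: less_Suc_eq)
    qed
    then show ?thesis using fin by (cases e) (auto simp: \<sigma>_def step_def)
  qed
  have total_flow: "(\<Sum>v\<in>V. node_flow w a v) = 0" for w
  proof -
    have "(\<Sum>e\<in>?D. w (step (snd e) (state a e)) - w (state a e)) =
        (\<Sum>e\<in>?D. w (\<sigma> (Suc (P e))) - w (\<sigma> (P e)))"
      by (intro sum.cong) (simp_all only: state_a step_\<sigma>)
    \<comment> \<open>Reindexing by position lists the edges along the path, where the sum
      telescopes; its boundary terms cancel against the root's virtual edge.\<close>
    also have "\<dots> = (\<Sum>p<2 * ?n. w (\<sigma> (Suc p)) - w (\<sigma> p))"
      by (rule sum.reindex_bij_betw[OF bij])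
    also have "\<dots> = w (\<sigma> (2 * ?n)) - w (\<sigma> 0)" by (rule sum_lessThan_telescope)
    also have "\<sigma> 0 = (0, 0)" by (simp add: \<sigma>_def)
    also have "\<sigma> (2 * ?n) = (?n, ?n)"
    proof -
      have "{u\<in>V. P (u, b) < 2 * ?n} = V" for b using bij_betwE[OF bij] by auto
      then show ?thesis by (simp add: \<sigma>_def)
    qed
    finally show ?thesis using sum_node_flow[of V a \<rho> w] fin \<rho> by simp
  qed
  have partial_sums: "\<exists>s. (\<forall>v\<in>V. s v \<in> agg_values N) \<and> (\<forall>v\<in>V. sum_check w v {u\<in>V. E v u} a s)"
    if w: "w \<in> states N \<rightarrow>\<^sub>E {0..3}" for w
  proof -
    from par[of "node_flow w a"] obtain s where agg: "aggregates E \<rho> V par (node_flow w a) s" by blast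
    have w_bd: "0 \<le> w q \<and> w q \<le> 3" if "q \<in> states N" for q using PiE_mem[OF w that] by simp
    have "\<bar>node_flow w a v\<bar> \<le> 9" if "v \<in> V" for v
    proof -
      have st: "\<sigma> p \<in> states N" "step b (\<sigma> p) \<in> states N" for b p
        using \<sigma>_in[of p] by (auto simp: states_def step_def mem_Times_iff)
      have "(0, 0) \<in> states N" "(?n, ?n) \<in> states N" using N by (auto simp: states_def)
      from w_bd[OF this(1)] w_bd[OF this(2)] w_bd[OF st(1)[of "P (v, True)"]] w_bd[OF st(1)[of "P (v, False)"]]
        w_bd[OF st(2)[of True "P (v, True)"]] w_bd[OF st(2)[of False "P (v, False)"]]
      show ?thesis by (auto simp: node_flow_def state_a UNIV_bool abs_le_iff)
    qed
    then have "(\<Sum>v\<in>V. \<bar>node_flow w a v\<bar>) \<le> 9 * int ?n"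
      using sum_bounded_above[of V "\<lambda>v. \<bar>node_flow w a v\<bar>" 9] by (simp add: mult.commute)
    then have "s v \<in> agg_values N" if "v \<in> V" for v
      using agg that N unfolding aggregates_def agg_values_def by fastforce
    moreover have "sum_check w v {u\<in>V. E v u} a s" if v: "v \<in> V" for v
    proof -
      have "{u. u \<in> {u\<in>V. E v u} \<and> u \<noteq> tree_root (a u) \<and> parent (a u) = v} = {u. u \<in> V \<and> u \<noteq> \<rho> \<and> par u = v}"
        using parE by auto
      then show ?thesis
        using agg v total_flow[of w] by (auto simp: sum_check_def aggregates_def)
    qed
    ultimately show ?thesis by blast
  qed
  show ?thesis
  proof (intro exI[of _ a] conjI ballI)
    fix w assume "w \<in> states N \<rightarrow>\<^sub>E {0..3 :: int}"
    from partial_sums[OF this] obtain s where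
      "\<forall>v\<in>V. s v \<in> agg_values N" "\<forall>v\<in>V. sum_check w v {u\<in>V. E v u} a s" by blast
    then show "\<exists>s. (\<forall>v\<in>V. s v \<in> agg_values N) \<and>
        (\<forall>v\<in>V. diagram_check v {u\<in>V. E v u} a \<and> sum_check w v {u\<in>V. E v u} a s)"
      using diagram by (intro exI[of _ s]) simp
  qed (rule certs)
qed

theorem theorem3:
  shows "in_dMAM_log circle_graph"
proof (rule in_dMAM_logI)
  fix c :: nat assume c: "c \<ge> 1"
  show "dMAM_protocol c circle_graph (2 * c + 6) (certs c) agg_values (\<lambda>N. states N \<rightarrow>\<^sub>E {0..3})
      (\<lambda>N w v S a s. diagram_check v S a \<and> sum_check w v S a s)"
    unfolding dMAM_protocol_def
  proof (intro conjI allI impI; (elim conjE)?)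
    show "\<exists>l. card (states N \<rightarrow>\<^sub>E {0..3 :: int}) = 2 ^ l" for N
      by (rule exI, rule card_weights)
  next
    fix v S a a' and s s' :: "nat \<Rightarrow> int"
    assume "\<forall>u\<in>insert v S. a u = a' u \<and> s u = s' u" "diagram_check v S a"
    then show "diagram_check v S a'" using diagram_check_cong[of v S a a'] by blast
  next
    fix w v S a a' s s'
    assume "\<forall>u\<in>insert v S. a u = a' u \<and> s u = s' u" "sum_check w v S a s"
    then show "sum_check w v S a' s'" by (rule sum_check_cong)
  next
    fix V E N
    assume "valid_config c V E" "card V \<le> N" "circle_graph V E"
    then show "\<exists>a. (\<forall>v\<in>V. a v \<in> certs c N) \<and>
      (\<forall>w\<in>states N \<rightarrow>\<^sub>E {0..3}. \<exists>s. (\<forall>v\<in>V. s v \<in> agg_values N) \<and>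
        (\<forall>v\<in>V. diagram_check v {u\<in>V. E v u} a \<and> sum_check w v {u\<in>V. E v u} a s))"
      by (rule completeness)
  next
    fix V E N a
    assume "valid_config c V E" "\<not> circle_graph V E" "\<forall>v\<in>V. a v \<in> certs c N"
    then show "3 * card {w \<in> states N \<rightarrow>\<^sub>E {0..3}. \<exists>s. (\<forall>v\<in>V. s v \<in> agg_values N) \<and>
        (\<forall>v\<in>V. diagram_check v {u\<in>V. E v u} a \<and> sum_check w v {u\<in>V. E v u} a s)}
      \<le> card (states N \<rightarrow>\<^sub>E {0..3 :: int})"
      by (intro soundness) auto
  qed (use certs_bound[OF c] agg_values_bound in auto)
qed

end
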